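(* Let $f$ be an AC symbol over a finite set $C$ of constants, $\gg_f$ a total admissible ordering on $f$-monomials extending a total ordering $\gg_C$ on $C$ in which every nonconstant $f$-monomial is greater than every constant, $R_f$ a canonical AC rewrite system on $f$-monomials oriented by $\gg_f$, and $R_C$ a canonical rewrite system of constant rules oriented by $\gg_C$. Let $S_f=\{l=r\mid l\rightarrow r\in R_f\}$ and $S_C=\{c=d\mid c\rightarrow d\in R_C\}$. Then the rewrite system $R'_f$ computed by ${\bf update}_{AC}(R_f,R_C,\gg_f)$ is a canonical rewrite system for $ACCC(S_f\cup S_C)$ with respect to $\gg_f$: it is terminating and confluent and, for all $f$-monomials $s,t$, $s=t\in ACCC(S_f\cup S_C)$ iff $s,t$ have the same normal form with respect to $R'_f$.
   Context: $f$-monomials: $f(M)$, $M$ a nonempty finite multiset over $C$; a constant $c$ is identified with $f(\{\!\{c\}\!\})$. On multisets $\cup$ is multiset sum, $\cap$ multiset intersection, $-$ truncated difference, $\subseteq$ sub-multiset. A rule $f(A)\rightarrow f(B)$ rewrites $f(M)$ to $f((M-A)\cup B)$ when $A\subseteq M$. Admissible: total well-founded ordering with $f(A)\gg_f f(B)$ when $B$ is a proper sub-multiset of $A$ and $f(A_1)\gg_f f(A_2)\Rightarrow f(A_1\cup B)\gg_f f(A_2\cup B)$. $ACCC(E)$: smallest equivalence relation on $f$-monomials containing $E$ such that $f(M_1)=f(M_2)$, $f(N_1)=f(N_2)$ in it imply $f(M_1\cup N_1)=f(M_2\cup N_2)$ in it. Critical pair of distinct rules $f(A_1)\rightarrow f(A_2)$,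 $f(B_1)\rightarrow f(B_2)$: $(f((AB-A_1)\cup A_2),f((AB-B_1)\cup B_2))$ with $AB=(A_1\cup B_1)-(A_1\cap B_1)$. $NF(t,R)$ denotes a normal form of $t$ w.r.t. $R$. Procedure ${\bf update}_{AC}(R_f,R_C,\gg_f)$: Let $S:=\{l=r\mid l\rightarrow r\in R_f,\ NF(l,R_C)\ne l\}$; remove these rules from $R_f$; $R'_f:=R_C\cup R_f$; $NR_C:=\emptyset$. While $S\ne\emptyset$: set $T:=\emptyset$; for each $l=r\in S$: remove it from $S$; if $NF(l,R'_f)\ne NF(r,R'_f)$, orient the pair of these normal forms by $\gg_f$ as $l'\rightarrow r'$; for each rule $l''\rightarrow r''\in R'_f$ compute their critical pair $(s_1,s_2)$ and, if $NF(s_1,R'_f)\ne NF(s_2,R'_f)$, add $NF(s_1,R'_f)=NF(s_2,R'_f)$ to $T$; add $l'\rightarrow r'$ to $R'_f$; interreduce the other rules of $R'_f$ by $l'\rightarrow r'$ (rules whose left side becomes reducible are removed and their equations put into $T$; rules where only the right side is reducible get a normalized right side); if $l'\rightarrow r'$ is a new constant rule, add it to $NR_C$. After the loop over $S$, set $S:=T$. Return $(R'_f,NR_C)$. *)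

theory Defs
  imports "HOL-Library.Multiset" "HOL-Library.Confluence"
begin

text \<open>
  The monomial \<open>f(M)\<close> is represented by the multiset \<open>M\<close> of its arguments, so that the constant
  \<open>c\<close> is \<open>{#c#}\<close>. Rules \<open>l \<rightarrow> r\<close> and equations \<open>l = r\<close> are both pairs \<open>(l, r)\<close>.
\<close>

type_synonym 'c rules = "('c multiset \<times> 'c multiset) set"

definition monomials :: "'c set \<Rightarrow> 'c multiset set" where
  "monomials C = {M. M \<noteq> {#} \<and> set_mset M \<subseteq> C}"

definition strict_total_order_on :: "'a set \<Rightarrow> ('a \<Rightarrow> 'a \<Rightarrow> bool) \<Rightarrow> bool" where
  "strict_total_order_on A gt \<longleftrightarrow> irreflp_on A gt \<and> transp_on A gt \<and> totalp_on A gt"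

definition admissible :: "'c set \<Rightarrow> ('c multiset \<Rightarrow> 'c multiset \<Rightarrow> bool) \<Rightarrow> bool" where
  "admissible C gt \<longleftrightarrow>
     strict_total_order_on (monomials C) gt \<and>
     wfp_on (monomials C) gt\<inverse>\<inverse> \<and>
     (\<forall>A\<in>monomials C. \<forall>B\<in>monomials C. B \<subset># A \<longrightarrow> gt A B) \<and>
     (\<forall>A\<^sub>1\<in>monomials C. \<forall>A\<^sub>2\<in>monomials C. \<forall>B. set_mset B \<subseteq> C \<longrightarrow>
        gt A\<^sub>1 A\<^sub>2 \<longrightarrow> gt (A\<^sub>1 + B) (A\<^sub>2 + B))"

definition oriented :: "'c set \<Rightarrow> ('c multiset \<Rightarrow> 'c multiset \<Rightarrow> bool) \<Rightarrow> 'c rules \<Rightarrow> bool" where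
  "oriented C gt R \<longleftrightarrow> (\<forall>(l, r)\<in>R. l \<in> monomials C \<and> r \<in> monomials C \<and> gt l r)"

definition rstep :: "'c set \<Rightarrow> 'c rules \<Rightarrow> 'c multiset \<Rightarrow> 'c multiset \<Rightarrow> bool" where
  "rstep C R M N \<longleftrightarrow> M \<in> monomials C \<and> (\<exists>(A, B)\<in>R. A \<subseteq># M \<and> N = (M - A) + B)"

definition reducible :: "'c set \<Rightarrow> 'c rules \<Rightarrow> 'c multiset \<Rightarrow> bool" where
  "reducible C R M \<longleftrightarrow> (\<exists>N. rstep C R M N)"

text \<open>
  \<open>NF C R t u\<close>: \<open>u\<close> is a normal form of \<open>t\<close>. This is a relation, since the systems occurring
  while the procedure runs need not be confluent.
\<close>

definition NF :: "'c set \<Rightarrow> 'c rules \<Rightarrow> 'c multiset \<Rightarrow> 'c multiset \<Rightarrow> bool" where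
  "NF C R t u \<longleftrightarrow> (rstep C R)\<^sup>*\<^sup>* t u \<and> \<not> reducible C R u"

definition canonical :: "('a \<Rightarrow> 'a \<Rightarrow> bool) \<Rightarrow> bool" where
  "canonical step \<longleftrightarrow> wfP step\<inverse>\<inverse> \<and> confluentp step"

inductive_set ACCC :: "'c set \<Rightarrow> 'c rules \<Rightarrow> 'c rules" for C :: "'c set" and E :: "'c rules" where
  base: "(s, t) \<in> E \<Longrightarrow> (s, t) \<in> ACCC C E"
| refl: "s \<in> monomials C \<Longrightarrow> (s, s) \<in> ACCC C E"
| sym: "(s, t) \<in> ACCC C E \<Longrightarrow> (t, s) \<in> ACCC C E"
| trans: "(s, t) \<in> ACCC C E \<Longrightarrow> (t, u) \<in> ACCC C E \<Longrightarrow> (s, u) \<in> ACCC C E"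
| union: "(M\<^sub>1, M\<^sub>2) \<in> ACCC C E \<Longrightarrow> (N\<^sub>1, N\<^sub>2) \<in> ACCC C E \<Longrightarrow>
    (M\<^sub>1 + N\<^sub>1, M\<^sub>2 + N\<^sub>2) \<in> ACCC C E"

definition canonical_for ::
  "'c set \<Rightarrow> ('c multiset \<Rightarrow> 'c multiset \<Rightarrow> bool) \<Rightarrow> 'c rules \<Rightarrow> 'c rules \<Rightarrow> bool" where
  "canonical_for C gt K R \<longleftrightarrow>
     oriented C gt R \<and> canonical (rstep C R) \<and>
     (\<forall>s\<in>monomials C. \<forall>t\<in>monomials C. (s, t) \<in> K \<longleftrightarrow> (\<exists>u. NF C R s u \<and> NF C R t u))"

fun critical_pair ::
  "'c multiset \<times> 'c multiset \<Rightarrow> 'c multiset \<times> 'c multiset \<Rightarrow> 'c multiset \<times> 'c multiset" where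
  "critical_pair (A\<^sub>1, A\<^sub>2) (B\<^sub>1, B\<^sub>2) =
     (let AB = (A\<^sub>1 + B\<^sub>1) - (A\<^sub>1 \<inter># B\<^sub>1) in ((AB - A\<^sub>1) + A\<^sub>2, (AB - B\<^sub>1) + B\<^sub>2))"

definition const_rules :: "('c \<times> 'c) set \<Rightarrow> 'c rules" where
  "const_rules R\<^sub>C = {({#c#}, {#d#}) | c d. (c, d) \<in> R\<^sub>C}"

text \<open>
  A state \<open>(S, T, R, N)\<close> of the procedure holds the values of \<open>S\<close>, \<open>T\<close>, \<open>R'\<^sub>f\<close> and \<open>NR\<^sub>C\<close>. Each
  \<open>discard\<close> or \<open>orient\<close> step is one iteration of the inner loop; \<open>next_round\<close> is the assignment
  \<open>S := T\<close> followed by \<open>T := \<emptyset>\<close> at the start of the next outer iteration. The order in which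
  equations are taken from \<open>S\<close> and the normal forms used are arbitrary.

  In \<open>orient\<close>, \<open>n\<^sub>1 \<rho>\<close> and \<open>n\<^sub>2 \<rho>\<close> are the chosen normal forms of the critical pair of the new rule
  with the rule \<open>\<rho>\<close>, and \<open>n\<^sub>3 \<rho>\<close> is the right side of \<open>\<rho>\<close> after interreduction. The rules may be
  interreduced in any order: a normal form computed from a system in which some rules are already
  removed or have new right sides is also a normal form with respect to \<open>insert (l', r') R\<close>.
\<close>

inductive update_step ::
  "'c set \<Rightarrow> ('c multiset \<Rightarrow> 'c multiset \<Rightarrow> bool) \<Rightarrow>
   'c rules \<times> 'c rules \<times> 'c rules \<times> ('c \<times> 'c) set \<Rightarrow>
   'c rules \<times> 'c rules \<times> 'c rules \<times> ('c \<times> 'c) set \<Rightarrow> bool"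
  for C :: "'c set" and gt :: "'c multiset \<Rightarrow> 'c multiset \<Rightarrow> bool" where
  discard:
  "\<lbrakk> (l, r) \<in> S; NF C R l u; NF C R r u \<rbrakk> \<Longrightarrow>
   update_step C gt (S, T, R, N) (S - {(l, r)}, T, R, N)"
| orient:
  "\<lbrakk> (l, r) \<in> S; NF C R l u; NF C R r v; u \<noteq> v;
     (l', r') = (u, v) \<or> (l', r') = (v, u); gt l' r';
     \<forall>\<rho>\<in>R. NF C R (fst (critical_pair (l', r') \<rho>)) (n\<^sub>1 \<rho>) \<and>
           NF C R (snd (critical_pair (l', r') \<rho>)) (n\<^sub>2 \<rho>);
     CP = {(n\<^sub>1 \<rho>, n\<^sub>2 \<rho>) | \<rho>. \<rho> \<in> R \<and> n\<^sub>1 \<rho> \<noteq> n\<^sub>2 \<rho>};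
     removed = {\<rho> \<in> R. reducible C {(l', r')} (fst \<rho>)};
     \<forall>\<rho>\<in>R - removed.
       if reducible C {(l', r')} (snd \<rho>)
       then NF C (insert (l', r') R) (snd \<rho>) (n\<^sub>3 \<rho>)
       else n\<^sub>3 \<rho> = snd \<rho> \<rbrakk> \<Longrightarrow>
   update_step C gt (S, T, R, N)
     (S - {(l, r)}, T \<union> CP \<union> removed,
      insert (l', r') {(fst \<rho>, n\<^sub>3 \<rho>) | \<rho>. \<rho> \<in> R - removed},
      N \<union> {(c, d). (l', r') = ({#c#}, {#d#})})"
| next_round:
  "T \<noteq> {} \<Longrightarrow> update_step C gt ({}, T, R, N) (T, {}, R, N)"

definition update_init ::
  "'c set \<Rightarrow> 'c rules \<Rightarrow> ('c \<times> 'c) set \<Rightarrow>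
   'c rules \<times> 'c rules \<times> 'c rules \<times> ('c \<times> 'c) set" where
  "update_init C R\<^sub>f R\<^sub>C =
     (let S = {(l, r) \<in> R\<^sub>f. \<exists>l'. NF C (const_rules R\<^sub>C) l l' \<and> l' \<noteq> l}
      in (S, {}, const_rules R\<^sub>C \<union> (R\<^sub>f - S), {}))"

text \<open>\<open>update_AC C gt R\<^sub>f R\<^sub>C R' N\<close>: some run of the procedure returns \<open>(R', N)\<close>.\<close>

definition update_AC ::
  "'c set \<Rightarrow> ('c multiset \<Rightarrow> 'c multiset \<Rightarrow> bool) \<Rightarrow> 'c rules \<Rightarrow> ('c \<times> 'c) set \<Rightarrow>
   'c rules \<Rightarrow> ('c \<times> 'c) set \<Rightarrow> bool" where
  "update_AC C gt R\<^sub>f R\<^sub>C R' N \<longleftrightarrow>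
     (update_step C gt)\<^sup>*\<^sup>* (update_init C R\<^sub>f R\<^sub>C) ({}, {}, R', N)"

definition update_AC_terminates ::
  "'c set \<Rightarrow> ('c multiset \<Rightarrow> 'c multiset \<Rightarrow> bool) \<Rightarrow> 'c rules \<Rightarrow> ('c \<times> 'c) set \<Rightarrow> bool" where
  "update_AC_terminates C gt R\<^sub>f R\<^sub>C \<longleftrightarrow>
     \<not> (\<exists>\<sigma>. \<sigma> 0 = update_init C R\<^sub>f R\<^sub>C \<and> (\<forall>i::nat. update_step C gt (\<sigma> i) (\<sigma> (Suc i))))"

end

theory Submission
  imports Defs Complex_Main
begin

text \<open>
  The procedure is a run of abstract completion on a set \<open>R\<close> of rules and a set \<open>Q = S \<union> T\<close> of
  pending equations: an equation is simplified, deleted or oriented, and a new rule reduces the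
  others. Throughout, the two ends of a peak \<open>a \<leftarrow> M \<rightarrow> b\<close> of \<open>R\<close> are linked by equations of \<open>R \<union> Q\<close>
  between monomials smaller than \<open>M\<close>, because an equation that disappears is replaced by rewriting
  its two sides, and rewriting only moves downwards. Once \<open>Q\<close> is empty, \<open>R\<close> is confluent by a
  generalized Newman lemma. Initially, a rule of \<open>R\<^sub>f\<close> that is not moved to \<open>S\<close> has a left side
  disjoint from those of \<open>R\<^sub>C\<close>, so no critical pairs between the two systems matter.

  The left side of each new rule is irreducible for the current system, and the upward closed set
  of reducible monomials never shrinks, so by Dickson's lemma only finitely many rules are created;
  between two such events \<open>|S| + 2 |T|\<close> decreases.
\<close>

section \<open>Abstract reduction\<close>

lemma wfp_imp_ex_normal_form:
  assumes "wfp r\<inverse>\<inverse>"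
  shows "\<exists>y. r\<^sup>*\<^sup>* x y \<and> (\<nexists>z. r y z)"
proof (induction x rule: wfp_induct_rule[OF assms, case_names less])
  case (less x)
  show ?case
  proof (cases "\<exists>z. r x z")
    case True
    then show ?thesis using less by (meson conversepI converse_rtranclp_into_rtranclp)
  qed blast
qed

definition confluent_at :: "('a \<Rightarrow> 'a \<Rightarrow> bool) \<Rightarrow> 'a \<Rightarrow> bool" where
  "confluent_at r x \<longleftrightarrow> (\<forall>y z. r\<^sup>*\<^sup>* x y \<longrightarrow> r\<^sup>*\<^sup>* x z \<longrightarrow> (\<exists>u. r\<^sup>*\<^sup>* y u \<and> r\<^sup>*\<^sup>* z u))"

lemma confluent_at_imp_joinable:
  assumes "\<And>x. P x \<Longrightarrow> confluent_at r x" and "equivclp (\<lambda>x y. P x \<and> P y \<and> r x y) s t"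
  shows "\<exists>u. r\<^sup>*\<^sup>* s u \<and> r\<^sup>*\<^sup>* t u"
  using assms(2)
proof (induction rule: equivclp_induct)
  case (step y z)
  then obtain u where u: "r\<^sup>*\<^sup>* s u" "r\<^sup>*\<^sup>* y u" by blast
  show ?case
  proof (cases "r z y")
    case True
    then show ?thesis using u converse_rtranclp_into_rtranclp by metis
  next
    case False
    then have "confluent_at r y" "r\<^sup>*\<^sup>* y z" using step.hyps(2) assms(1) by blast+
    then obtain v where "r\<^sup>*\<^sup>* u v" "r\<^sup>*\<^sup>* z v" using u(2) unfolding confluent_at_def by blast
    then show ?thesis using rtranclp_trans[OF u(1)] by blast
  qed
qed blast

text \<open>The Winkler--Buchberger generalization of Newman's lemma.\<close>

lemma connected_below_imp_confluentp:
  assumes "wfp lt" and decreasing: "\<And>x y. r x y \<Longrightarrow> lt y x"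
    and connected: "\<And>x y z. r x y \<Longrightarrow> r x z \<Longrightarrow>
      equivclp (\<lambda>u v. lt u x \<and> lt v x \<and> r u v) y z"
  shows "confluentp r"
proof -
  have "confluent_at r x" for x
  proof (induction x rule: wfp_induct_rule[OF assms(1), case_names less])
    case (less x)
    have "\<exists>w. r\<^sup>*\<^sup>* y w \<and> r\<^sup>*\<^sup>* z w" if y: "r\<^sup>*\<^sup>* x y" and z: "r\<^sup>*\<^sup>* x z" for y z
    proof (cases "x = y \<or> x = z")
      case True
      then show ?thesis using y z by blast
    next
      case False
      obtain y' z' where y': "r x y'" "r\<^sup>*\<^sup>* y' y" and z': "r x z'" "r\<^sup>*\<^sup>* z' z"
        using y z False by (metis converse_rtranclpE)
      obtain u where u: "r\<^sup>*\<^sup>* y' u" "r\<^sup>*\<^sup>* z' u"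
        using confluent_at_imp_joinable[OF less connected[OF y'(1) z'(1)]] by blast
      obtain v where v: "r\<^sup>*\<^sup>* y v" "r\<^sup>*\<^sup>* u v"
        using less[OF decreasing[OF y'(1)]] y'(2) u(1) unfolding confluent_at_def by blast
      obtain w where w: "r\<^sup>*\<^sup>* v w" "r\<^sup>*\<^sup>* z w"
        using less[OF decreasing[OF z'(1)]] z'(2) rtranclp_trans[OF u(2) v(2)]
        unfolding confluent_at_def by blast
      show ?thesis using rtranclp_trans[OF v(1) w(1)] w(2) by blast
    qed
    then show ?case by (simp add: confluent_at_def)
  qed
  then show ?thesis by (intro confluentpI) (simp add: confluent_at_def)
qed

section \<open>Dickson's lemma\<close>

lemma wellorder_seq_incseq_subseq:
  fixes f :: "nat \<Rightarrow> 'a::wellorder"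
  obtains g :: "nat \<Rightarrow> nat" where "strict_mono g" and "incseq (f \<circ> g)"
proof -
  obtain g where g: "strict_mono g" "monoseq (f \<circ> g)"
    using seq_monosub[of f] by (auto simp: comp_def)
  then consider (increasing) "incseq (f \<circ> g)" | (decreasing) "decseq (f \<circ> g)"
    by (auto simp: monoseq_iff)
  then show thesis
  proof cases
    case decreasing
    define m where "m = (LEAST y. y \<in> range (f \<circ> g))"
    have "m \<in> range (f \<circ> g)" unfolding m_def by (rule LeastI) blast
    then obtain k where k: "m = (f \<circ> g) k" by blast
    have "(f \<circ> g) (k + n) = m" for n
    proof (rule antisym)
      show "(f \<circ> g) (k + n) \<le> m" unfolding k by (rule decseqD[OF decreasing]) simp
      show "m \<le> (f \<circ> g) (k + n)" unfolding m_def by (rule Least_le) blast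
    qed
    then have "incseq (f \<circ> (g \<circ> (+) k))" by (simp add: incseq_def)
    moreover have "strict_mono (g \<circ> (+) k)" using g(1) by (simp add: strict_mono_def)
    ultimately show thesis using that by blast
  qed (use g(1) that in blast)
qed

lemma count_incseq_subseq:
  fixes x :: "nat \<Rightarrow> 'c multiset"
  assumes "finite C"
  shows "\<exists>g :: nat \<Rightarrow> nat. strict_mono g \<and> (\<forall>c\<in>C. incseq (\<lambda>i. count (x (g i)) c))"
  using assms
proof (induction C)
  case empty
  then show ?case using strict_mono_id by blast
next
  case (insert c C)
  then obtain g where g: "strict_mono g" "\<forall>c\<in>C. incseq (\<lambda>i. count (x (g i)) c)" by blast
  obtain h where h: "strict_mono h" "incseq ((\<lambda>i. count (x (g i)) c) \<circ> h)"
    by (rule wellorder_seq_incseq_subseq)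
  have "incseq (\<lambda>i. count (x ((g \<circ> h) i)) d)" if "d \<in> insert c C" for d
  proof (cases "d = c")
    case True
    then show ?thesis using h(2) by (simp add: comp_def)
  next
    case False
    then have "incseq (\<lambda>i. count (x (g i)) d)" using g(2) that by blast
    then show ?thesis using strict_mono_mono[OF h(1)] by (auto simp: incseq_def mono_def)
  qed
  then show ?case using strict_mono_o[OF g(1) h(1)] by blast
qed

lemma dickson:
  fixes x :: "nat \<Rightarrow> 'c multiset"
  assumes "finite C" and "\<And>i. set_mset (x i) \<subseteq> C"
  obtains i j where "i < j" and "x i \<subseteq># x j"
proof -
  obtain g where g: "strict_mono g" "\<forall>c\<in>C. incseq (\<lambda>i. count (x (g i)) c)"
    using count_incseq_subseq[OF assms(1)] by blast
  have "x (g 0) \<subseteq># x (g 1)"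
  proof (rule mset_subset_eqI)
    fix c
    show "count (x (g 0)) c \<le> count (x (g 1)) c"
    proof (cases "c \<in> C")
      case True
      then show ?thesis using g(2) incseqD[of "\<lambda>i. count (x (g i)) c" 0 1] by simp
    next
      case False
      then have "c \<notin># x (g 0)" using assms(2) by blast
      then show ?thesis by (simp add: not_in_iff)
    qed
  qed
  moreover have "g 0 < g 1" using g(1) by (simp add: strict_mono_def)
  ultimately show thesis using that by blast
qed

definition upward_closed :: "'c set \<Rightarrow> 'c multiset set \<Rightarrow> bool" where
  "upward_closed C U \<longleftrightarrow> (\<forall>x\<in>U. set_mset x \<subseteq> C) \<and>
     (\<forall>x\<in>U. \<forall>y. x \<subseteq># y \<longrightarrow> set_mset y \<subseteq> C \<longrightarrow> y \<in> U)"

lemma wf_upward_closed_superset: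
  assumes "finite C"
  shows "wf {(V, U). upward_closed C U \<and> upward_closed C V \<and> U \<subset> V}"
  unfolding wf_iff_no_infinite_down_chain
proof
  assume "\<exists>U. \<forall>i. (U (Suc i), U i) \<in> {(V, U). upward_closed C U \<and> upward_closed C V \<and> U \<subset> V}"
  then obtain U where "\<forall>i. upward_closed C (U i) \<and> upward_closed C (U (Suc i)) \<and> U i \<subset> U (Suc i)"
    by (simp only: mem_Collect_eq case_prod_conv) blast
  then have closed: "upward_closed C (U i)" and chain: "U i \<subset> U (Suc i)" for i by blast+
  have "incseq U" using chain by (intro incseq_SucI) blast
  have "\<forall>i. \<exists>x. x \<in> U (Suc i) \<and> x \<notin> U i" using chain by blast
  from choice[OF this] obtain x where x: "\<And>i. x i \<in> U (Suc i)" "\<And>i. x i \<notin> U i" by blast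
  have x_subset: "set_mset (x i) \<subseteq> C" for i using x(1) closed unfolding upward_closed_def by blast
  obtain i j where ascent: "i < j" "x i \<subseteq># x j" using dickson[OF assms x_subset] .
  then have "x i \<in> U j" using x(1) incseqD[OF \<open>incseq U\<close>, of "Suc i" j] by auto
  then have "x j \<in> U j" using closed[of j] ascent(2) x_subset unfolding upward_closed_def by blast
  then show False using x(2) by blast
qed

section \<open>Rewriting of monomials\<close>

lemma monomials_add: "M \<in> monomials C \<Longrightarrow> set_mset X \<subseteq> C \<Longrightarrow> M + X \<in> monomials C"
  by (auto simp: monomials_def)

lemma monomials_addD: "M + X \<in> monomials C \<Longrightarrow> set_mset X \<subseteq> C"
  by (simp add: monomials_def)

lemma monomials_diffD: "M \<in> monomials C \<Longrightarrow> set_mset (M - N) \<subseteq> C"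
  by (auto simp: monomials_def dest: in_diffD)

lemma monomials_diff_add:
  "M \<in> monomials C \<Longrightarrow> B \<in> monomials C \<Longrightarrow> (M - A) + B \<in> monomials C"
  by (auto simp: monomials_def dest: in_diffD)

lemma rstep_iff:
  "rstep C R M N \<longleftrightarrow> M \<in> monomials C \<and> (\<exists>(l, r)\<in>R. \<exists>X. M = l + X \<and> N = r + X)"
proof -
  have "l \<subseteq># M \<and> N = (M - l) + r \<longleftrightarrow> (\<exists>X. M = l + X \<and> N = r + X)" for l r
    by (auto simp: mset_subset_eq_exists_conv add.commute)
  then show ?thesis by (simp add: rstep_def)
qed

lemma rstep_rule: "(l, r) \<in> R \<Longrightarrow> l + X \<in> monomials C \<Longrightarrow> rstep C R (l + X) (r + X)"
  unfolding rstep_iff by blast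

lemma rstep_add: "rstep C R M N \<Longrightarrow> set_mset X \<subseteq> C \<Longrightarrow> rstep C R (M + X) (N + X)"
  unfolding rstep_iff by (auto simp: monomials_add intro!: bexI exI add.assoc)

lemma equivclp_rstep_add:
  "equivclp (rstep C R) M N \<Longrightarrow> set_mset X \<subseteq> C \<Longrightarrow> equivclp (rstep C R) (M + X) (N + X)"
  by (induction rule: equivclp_induct) (auto intro: equivclp_into_equivclp rstep_add)

lemma rstep_mono: "R \<subseteq> R' \<Longrightarrow> rstep C R \<le> rstep C R'"
  unfolding rstep_iff by (intro predicate2I) blast

lemma rsteps_mono: "R \<subseteq> R' \<Longrightarrow> (rstep C R)\<^sup>*\<^sup>* M N \<Longrightarrow> (rstep C R')\<^sup>*\<^sup>* M N"
  using rtranclp_mono[OF rstep_mono] by blast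

lemma rstep_Un: "rstep C (R\<^sub>1 \<union> R\<^sub>2) M N \<longleftrightarrow> rstep C R\<^sub>1 M N \<or> rstep C R\<^sub>2 M N"
  by (auto simp: rstep_def)

lemma reducible_iff: "reducible C R M \<longleftrightarrow> M \<in> monomials C \<and> (\<exists>(l, r)\<in>R. l \<subseteq># M)"
  by (auto simp: reducible_def rstep_def)

lemma upward_closed_reducible: "upward_closed C {M. reducible C R M}"
  unfolding upward_closed_def
proof (intro conjI ballI allI impI)
  fix M N assume "M \<in> {M. reducible C R M}" "M \<subseteq># N" "set_mset N \<subseteq> C"
  then show "N \<in> {M. reducible C R M}"
    using subset_mset.order_trans[of _ M N] by (force simp: reducible_iff monomials_def)
qed (auto simp: reducible_iff monomials_def)

lemma reducible_insert_psubset: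
  assumes new: "fst \<rho> \<in> monomials C" "\<not> reducible C R (fst \<rho>)"
    and R': "R' = insert \<rho> {(fst \<rho>', n \<rho>') | \<rho>'. \<rho>' \<in> R - {\<rho>' \<in> R. reducible C {\<rho>} (fst \<rho>')}}"
  shows "{M. reducible C R M} \<subset> {M. reducible C R' M}"
proof
  show "{M. reducible C R M} \<subseteq> {M. reducible C R' M}"
  proof
    fix M assume "M \<in> {M. reducible C R M}"
    then obtain a b where rule: "(a, b) \<in> R" "a \<subseteq># M" and M: "M \<in> monomials C"
      unfolding reducible_iff by blast
    have "\<exists>(l, r)\<in>R'. l \<subseteq># M"
    proof (cases "reducible C {\<rho>} a")
      case True
      then have "fst \<rho> \<subseteq># a" by (auto simp: reducible_iff)
      then have "fst \<rho> \<subseteq># M" using rule(2) by (rule subset_mset.order_trans)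
      then show ?thesis unfolding R' by (auto simp: case_prod_beta)
    next
      case False
      then have "(a, n (a, b)) \<in> R'" using rule(1) unfolding R' by force
      then show ?thesis using rule(2) by blast
    qed
    then show "M \<in> {M. reducible C R' M}" using M by (simp add: reducible_iff)
  qed
  have "reducible C R' (fst \<rho>)" using new(1) by (auto simp: reducible_iff R' case_prod_beta)
  then show "{M. reducible C R M} \<noteq> {M. reducible C R' M}" using new(2) by blast
qed

lemma critical_pair_eq:
  "critical_pair (A\<^sub>1, A\<^sub>2) (B\<^sub>1, B\<^sub>2) = ((B\<^sub>1 - A\<^sub>1) + A\<^sub>2, (A\<^sub>1 - B\<^sub>1) + B\<^sub>2)"
  by (simp add: Let_def multiset_eq_iff)

lemma peak_is_critical_pair_instance:
  fixes A\<^sub>1 :: "'c multiset"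
  assumes "A\<^sub>1 + X\<^sub>1 = B\<^sub>1 + X\<^sub>2"
  obtains X where "A\<^sub>2 + X\<^sub>1 = fst (critical_pair (A\<^sub>1, A\<^sub>2) (B\<^sub>1, B\<^sub>2)) + X"
    and "B\<^sub>2 + X\<^sub>2 = snd (critical_pair (A\<^sub>1, A\<^sub>2) (B\<^sub>1, B\<^sub>2)) + X"
proof -
  have split: "X = (B - A) + (X \<inter># Y)" if "A + X = B + Y" for A B X Y :: "'c multiset"
  proof (rule multiset_eqI)
    fix x
    have "count A x + count X x = count B x + count Y x" using that by (metis count_union)
    then show "count X x = count ((B - A) + (X \<inter># Y)) x" by (simp add: min_def) arith
  qed
  have "X\<^sub>2 = (A\<^sub>1 - B\<^sub>1) + (X\<^sub>1 \<inter># X\<^sub>2)"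
    using split[OF assms[symmetric]] unfolding subset_mset.inf_commute[of X\<^sub>2 X\<^sub>1] .
  with split[OF assms] obtain X where "X\<^sub>1 = (B\<^sub>1 - A\<^sub>1) + X" "X\<^sub>2 = (A\<^sub>1 - B\<^sub>1) + X"
    by blast
  then show thesis
    using that[of X] unfolding critical_pair_eq by (simp add: ac_simps)
qed

section \<open>The AC congruence closure as convertibility\<close>

lemma ACCC_subset_monomials:
  assumes "E \<subseteq> monomials C \<times> monomials C"
  shows "ACCC C E \<subseteq> monomials C \<times> monomials C"
proof -
  have "s \<in> monomials C \<and> t \<in> monomials C" if "(s, t) \<in> ACCC C E" for s t
    using that by induction (use assms in \<open>auto simp: monomials_def\<close>)
  then show ?thesis by auto
qed

lemma ACCC_superset: "E \<subseteq> ACCC C E"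
  by (auto intro: ACCC.base)

lemma ACCC_least:
  assumes "E' \<subseteq> ACCC C E"
  shows "ACCC C E' \<subseteq> ACCC C E"
proof -
  have "(s, t) \<in> ACCC C E" if "(s, t) \<in> ACCC C E'" for s t
    using that by induction (use assms in \<open>auto intro: ACCC.intros\<close>)
  then show ?thesis by auto
qed

lemma ACCC_add:
  assumes "(s, t) \<in> ACCC C E" and "set_mset X \<subseteq> C"
  shows "(s + X, t + X) \<in> ACCC C E"
proof (cases "X = {#}")
  case False
  then have "X \<in> monomials C" using assms(2) by (simp add: monomials_def)
  then show ?thesis using assms(1) by (blast intro: ACCC.union ACCC.refl)
qed (use assms(1) in simp)

lemma equivclp_rstep_imp_ACCC:
  assumes "R \<subseteq> ACCC C E" and "equivclp (rstep C R) s t" and "s \<in> monomials C"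
  shows "(s, t) \<in> ACCC C E"
proof -
  have rstep_ACCC: "(y, z) \<in> ACCC C E" if "rstep C R y z" for y z
    using that assms(1) ACCC_add monomials_addD unfolding rstep_iff by blast
  show ?thesis
    using assms(2)
  proof (induction rule: equivclp_induct)
    case base
    show ?case using assms(3) by (rule ACCC.refl)
  next
    case (step y z)
    then have "(y, z) \<in> ACCC C E" using rstep_ACCC ACCC.sym by blast
    then show ?case using step.IH ACCC.trans by blast
  qed
qed

lemma ACCC_iff_equivclp_rstep:
  assumes "E \<subseteq> monomials C \<times> monomials C"
  shows "(s, t) \<in> ACCC C E \<longleftrightarrow>
    s \<in> monomials C \<and> t \<in> monomials C \<and> equivclp (rstep C E) s t"
proof
  assume "(s, t) \<in> ACCC C E"
  then have "equivclp (rstep C E) s t"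
  proof induction
    case (base s t)
    then have "rstep C E s t" using rstep_rule[of s t E "{#}"] assms by auto
    then show ?case by blast
  next
    case (union M\<^sub>1 M\<^sub>2 N\<^sub>1 N\<^sub>2)
    have "M\<^sub>2 \<in> monomials C" "N\<^sub>1 \<in> monomials C"
      using union.hyps ACCC_subset_monomials[OF assms] by auto
    then have "set_mset M\<^sub>2 \<subseteq> C" "set_mset N\<^sub>1 \<subseteq> C" by (simp_all add: monomials_def)
    then have "equivclp (rstep C E) (M\<^sub>1 + N\<^sub>1) (M\<^sub>2 + N\<^sub>1)"
      and "equivclp (rstep C E) (M\<^sub>2 + N\<^sub>1) (M\<^sub>2 + N\<^sub>2)"
      using equivclp_rstep_add[OF union.IH(1), of N\<^sub>1] equivclp_rstep_add[OF union.IH(2), of M\<^sub>2]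
      by (simp_all add: add.commute)
    then show ?case by (rule equivclp_trans)
  qed (auto intro: equivclp_sym equivclp_trans)
  then show "s \<in> monomials C \<and> t \<in> monomials C \<and> equivclp (rstep C E) s t"
    using ACCC_subset_monomials[OF assms] \<open>(s, t) \<in> ACCC C E\<close> by blast
next
  show "(s, t) \<in> ACCC C E"
    if "s \<in> monomials C \<and> t \<in> monomials C \<and> equivclp (rstep C E) s t"
    using equivclp_rstep_imp_ACCC[OF ACCC_superset] that by blast
qed

lemma critical_pair_in_ACCC:
  assumes E: "E \<subseteq> monomials C \<times> monomials C" and "\<rho>\<^sub>1 \<in> ACCC C E" and "\<rho>\<^sub>2 \<in> ACCC C E"
  shows "critical_pair \<rho>\<^sub>1 \<rho>\<^sub>2 \<in> ACCC C E"
proof -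
  obtain A\<^sub>1 A\<^sub>2 B\<^sub>1 B\<^sub>2 where \<rho>: "\<rho>\<^sub>1 = (A\<^sub>1, A\<^sub>2)" "\<rho>\<^sub>2 = (B\<^sub>1, B\<^sub>2)" by fastforce
  have "A\<^sub>1 \<in> monomials C" "B\<^sub>1 \<in> monomials C"
    using ACCC_subset_monomials[OF E] assms(2,3) unfolding \<rho> by auto
  then have "(A\<^sub>1 + (B\<^sub>1 - A\<^sub>1), A\<^sub>2 + (B\<^sub>1 - A\<^sub>1)) \<in> ACCC C E"
    and "(B\<^sub>1 + (A\<^sub>1 - B\<^sub>1), B\<^sub>2 + (A\<^sub>1 - B\<^sub>1)) \<in> ACCC C E"
    using assms(2,3) ACCC_add monomials_diffD unfolding \<rho> by blast+
  moreover have "A\<^sub>1 + (B\<^sub>1 - A\<^sub>1) = B\<^sub>1 + (A\<^sub>1 - B\<^sub>1)" by (auto simp: multiset_eq_iff)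
  ultimately show ?thesis
    unfolding \<rho> critical_pair_eq by (metis ACCC.sym ACCC.trans add.commute)
qed

lemma ACCC_rsteps:
  assumes "(s, t) \<in> ACCC C E" and "E \<subseteq> monomials C \<times> monomials C" and "R \<subseteq> ACCC C E"
    and "(rstep C R)\<^sup>*\<^sup>* s u" and "(rstep C R)\<^sup>*\<^sup>* t v"
  shows "(u, v) \<in> ACCC C E"
proof -
  have "s \<in> monomials C" "t \<in> monomials C"
    using ACCC_subset_monomials[OF assms(2)] assms(1) by auto
  then have "(s, u) \<in> ACCC C E" "(t, v) \<in> ACCC C E"
    using equivclp_rstep_imp_ACCC[OF assms(3) rtranclp_into_equivclp] assms(4,5) by blast+
  then show ?thesis using assms(1) ACCC.sym ACCC.trans by blast
qed

section \<open>Conversions below a bound\<close>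

locale admissible_order =
  fixes C :: "'c set" and gt :: "'c multiset \<Rightarrow> 'c multiset \<Rightarrow> bool"
  assumes admissible: "admissible C gt"
begin

abbreviation Mon :: "'c multiset set" where "Mon \<equiv> monomials C"

definition below :: "'c multiset \<Rightarrow> 'c multiset set" where
  "below M = {N. M \<in> Mon \<and> N \<in> Mon \<and> gt M N}"

lemma below_subset_Mon: "below M \<subseteq> Mon"
  by (auto simp: below_def)

lemma below_trans: "N \<in> below M \<Longrightarrow> below N \<subseteq> below M"
  using admissible unfolding below_def admissible_def strict_total_order_on_def
  by (auto dest: transp_onD)

lemma below_total: "\<lbrakk>M \<noteq> N; M \<in> Mon; N \<in> Mon\<rbrakk> \<Longrightarrow> N \<in> below M \<or> M \<in> below N"
  using admissible unfolding below_def admissible_def strict_total_order_on_def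
  by (auto dest: totalp_onD)

lemma below_add: "N \<in> below M \<Longrightarrow> set_mset X \<subseteq> C \<Longrightarrow> N + X \<in> below (M + X)"
  using admissible unfolding below_def admissible_def by (simp add: monomials_add)

lemma wfp_below: "wfp (\<lambda>N M. N \<in> below M)"
proof -
  have "(\<lambda>N M. N \<in> below M) = (\<lambda>N M. gt\<inverse>\<inverse> N M \<and> N \<in> Mon \<and> M \<in> Mon)"
    by (auto simp: below_def fun_eq_iff)
  moreover have "wfp_on Mon gt\<inverse>\<inverse>" using admissible by (simp add: admissible_def)
  ultimately show ?thesis by (simp only: wfp_on_iff_wfp[of Mon])
qed

lemma oriented_iff: "oriented C gt R \<longleftrightarrow> (\<forall>(l, r)\<in>R. r \<in> below l)"
  by (auto simp: oriented_def below_def)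

lemma oriented_subset_Mon: "oriented C gt R \<Longrightarrow> R \<subseteq> Mon \<times> Mon"
  by (auto simp: oriented_def)

lemma rule_below:
  "\<lbrakk>oriented C gt R; (l, r) \<in> R; l + X \<in> Mon\<rbrakk> \<Longrightarrow> r + X \<in> below (l + X)"
  unfolding oriented_iff using below_add monomials_addD by blast

lemma rstep_below: "oriented C gt R \<Longrightarrow> rstep C R M N \<Longrightarrow> N \<in> below M"
  unfolding rstep_iff using rule_below by blast

lemma wfp_rstep: "oriented C gt R \<Longrightarrow> wfp (rstep C R)\<inverse>\<inverse>"
  by (rule wfp_subset[OF wfp_below]) (auto dest: rstep_below)

lemma NF_exists: "oriented C gt R \<Longrightarrow> \<exists>N. NF C R M N"
  unfolding NF_def reducible_def using wfp_imp_ex_normal_form[OF wfp_rstep] by blast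

definition down_closed :: "'c multiset set \<Rightarrow> bool" where
  "down_closed D \<longleftrightarrow> D \<subseteq> Mon \<and> (\<forall>M\<in>D. below M \<subseteq> D)"

lemma down_closed_Mon: "down_closed Mon"
  by (auto simp: down_closed_def below_def)

lemma down_closed_below: "down_closed (below M)"
  using below_trans below_subset_Mon by (auto simp: down_closed_def)

definition conv :: "'c rules \<Rightarrow> 'c multiset set \<Rightarrow> 'c multiset \<Rightarrow> 'c multiset \<Rightarrow> bool" where
  "conv E D = equivclp (\<lambda>s t. s \<in> D \<and> t \<in> D \<and> rstep C E s t)"

lemma conv_refl [simp]: "conv E D s s"
  by (simp add: conv_def)

lemma conv_sym: "conv E D s t \<Longrightarrow> conv E D t s"
  unfolding conv_def by (rule equivclp_sym)

lemma conv_trans [trans]: "conv E D s t \<Longrightarrow> conv E D t u \<Longrightarrow> conv E D s u"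
  unfolding conv_def by (rule equivclp_trans)

lemma conv_equation:
  assumes "down_closed D" and "(l, r) \<in> E" and "l + X \<in> D" and "r + X \<in> D"
  shows "conv E D (l + X) (r + X)"
proof -
  have "l + X \<in> Mon" using assms(1,3) by (auto simp: down_closed_def)
  then have "rstep C E (l + X) (r + X)" by (rule rstep_rule[OF assms(2)])
  then show ?thesis unfolding conv_def using assms(3,4) by (intro r_into_equivclp) simp
qed

lemma conv_Mon:
  assumes "E \<subseteq> Mon \<times> Mon"
  shows "conv E Mon = equivclp (rstep C E)"
proof -
  have "s \<in> Mon \<and> t \<in> Mon" if "rstep C E s t" for s t
    using that assms monomials_diff_add[of s C] unfolding rstep_def by blast
  then have "(\<lambda>s t. s \<in> Mon \<and> t \<in> Mon \<and> rstep C E s t) = rstep C E" by blast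
  then show ?thesis by (simp add: conv_def)
qed

lemma rsteps_add_conv:
  assumes "oriented C gt R" and "down_closed D" and "(rstep C R)\<^sup>*\<^sup>* s t" and "s + X \<in> D"
  shows "t + X \<in> D \<and> conv R D (s + X) (t + X)"
  using assms(3)
proof (induction rule: rtranclp_induct)
  case base
  show ?case using assms(4) by simp
next
  case (step y z)
  have "y + X \<in> Mon" using step.IH assms(2) by (auto simp: down_closed_def)
  then have step_add: "rstep C R (y + X) (z + X)"
    using rstep_add[OF step.hyps(2)] monomials_addD by blast
  then have "z + X \<in> D"
    using step.IH rstep_below[OF assms(1)] assms(2) unfolding down_closed_def by blast
  then show ?case
    using step.IH step_add unfolding conv_def by (blast intro: equivclp_into_equivclp)
qed

lemma rsteps_conv:
  assumes "oriented C gt R" and "down_closed D" and "(rstep C R)\<^sup>*\<^sup>* s t" and "s \<in> D"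
  shows "t \<in> D \<and> conv R D s t"
  using rsteps_add_conv[OF assms(1-3), of "{#}"] assms(4) by simp

lemma NF_in_Mon: "\<lbrakk>oriented C gt R; NF C R s t; s \<in> Mon\<rbrakk> \<Longrightarrow> t \<in> Mon"
  unfolding NF_def using rsteps_conv[OF _ down_closed_Mon] by blast

definition covered_by :: "'c rules \<Rightarrow> 'c rules \<Rightarrow> bool" where
  "covered_by E E' \<longleftrightarrow> (\<forall>D. down_closed D \<longrightarrow> conv E D \<le> conv E' D)"

lemma covered_byD: "covered_by E E' \<Longrightarrow> down_closed D \<Longrightarrow> conv E D s t \<Longrightarrow> conv E' D s t"
  by (auto simp: covered_by_def)

lemma conv_le_conv:
  assumes "\<And>l r X. \<lbrakk>(l, r) \<in> E; l + X \<in> D; r + X \<in> D\<rbrakk> \<Longrightarrow> conv E' D' (l + X) (r + X)"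
  shows "conv E D \<le> conv E' D'"
proof (rule predicate2I)
  fix s t assume "conv E D s t"
  then show "conv E' D' s t"
    unfolding conv_def[of E D]
  proof (induction rule: equivclp_induct)
    case (step y z)
    then have "conv E' D' y z" using assms conv_sym unfolding rstep_iff by blast
    then show ?case using step.IH conv_trans by blast
  qed simp
qed

lemma covered_byI:
  assumes "\<And>D l r X. \<lbrakk>down_closed D; (l, r) \<in> E; l + X \<in> D; r + X \<in> D\<rbrakk> \<Longrightarrow>
    conv E' D (l + X) (r + X)"
  shows "covered_by E E'"
  unfolding covered_by_def using conv_le_conv[OF assms] by simp

lemma conv_mono_domain: "D \<subseteq> D' \<Longrightarrow> down_closed D' \<Longrightarrow> conv E D s t \<Longrightarrow> conv E D' s t"
  using conv_le_conv[of E D E D'] conv_equation[of D'] by blast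

lemma covered_by_subset: "E \<subseteq> E' \<Longrightarrow> covered_by E E'"
  by (rule covered_byI) (blast intro: conv_equation)

lemma covered_by_Un:
  assumes "covered_by E\<^sub>1 E'" and "covered_by E\<^sub>2 E'"
  shows "covered_by (E\<^sub>1 \<union> E\<^sub>2) E'"
proof (rule covered_byI)
  fix D l r X assume D: "down_closed D" and equation: "(l, r) \<in> E\<^sub>1 \<union> E\<^sub>2" "l + X \<in> D" "r + X \<in> D"
  then have "conv E\<^sub>1 D (l + X) (r + X) \<or> conv E\<^sub>2 D (l + X) (r + X)"
    using conv_equation[OF D] by blast
  then show "conv E' D (l + X) (r + X)" using covered_byD[OF _ D] assms by blast
qed

lemma covered_by_imp_ACCC_subset:
  assumes "covered_by E E'" and "E \<subseteq> Mon \<times> Mon" and "E' \<subseteq> Mon \<times> Mon"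
  shows "ACCC C E \<subseteq> ACCC C E'"
  using covered_byD[OF assms(1) down_closed_Mon] assms(2,3)
  by (auto simp: ACCC_iff_equivclp_rstep conv_Mon)

definition joins_modulo :: "'c rules \<Rightarrow> 'c rules \<Rightarrow> 'c multiset \<times> 'c multiset \<Rightarrow> bool" where
  "joins_modulo R E = (\<lambda>(s, t). \<exists>u v. (rstep C R)\<^sup>*\<^sup>* s u \<and> (rstep C R)\<^sup>*\<^sup>* t v \<and>
     (u = v \<or> (u, v) \<in> E \<or> (v, u) \<in> E))"

lemma joins_modulo_mono: "\<lbrakk>R \<subseteq> R'; E \<subseteq> E'; joins_modulo R E p\<rbrakk> \<Longrightarrow> joins_modulo R' E' p"
  unfolding joins_modulo_def case_prod_beta using rsteps_mono[of R R'] by blast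

lemma joins_modulo_conv:
  assumes R: "oriented C gt R" "covered_by R E" and D: "down_closed D"
    and "joins_modulo R E (s, t)" and "s + X \<in> D" and "t + X \<in> D"
  shows "conv E D (s + X) (t + X)"
proof -
  obtain u v where rsteps: "(rstep C R)\<^sup>*\<^sup>* s u" "(rstep C R)\<^sup>*\<^sup>* t v"
    and uv: "u = v \<or> (u, v) \<in> E \<or> (v, u) \<in> E"
    using assms(4) by (auto simp: joins_modulo_def)
  have reduct_s: "u + X \<in> D" "conv E D (s + X) (u + X)"
    using rsteps_add_conv[OF R(1) D rsteps(1) assms(5)] covered_byD[OF R(2) D] by blast+
  have reduct_t: "v + X \<in> D" "conv E D (t + X) (v + X)"
    using rsteps_add_conv[OF R(1) D rsteps(2) assms(6)] covered_byD[OF R(2) D] by blast+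
  note reduct_s(2)
  also have "conv E D (u + X) (v + X)"
    using uv conv_equation[OF D _ reduct_s(1) reduct_t(1)]
      conv_sym[OF conv_equation[OF D _ reduct_t(1) reduct_s(1)]]
    by (elim disjE) simp_all
  also have "conv E D (v + X) (t + X)" using reduct_t(2) by (rule conv_sym)
  finally show ?thesis .
qed

lemma joins_modulo_imp_covered_by:
  "\<lbrakk>oriented C gt R; covered_by R E; \<And>p. p \<in> P \<Longrightarrow> joins_modulo R E p\<rbrakk> \<Longrightarrow> covered_by P E"
  by (rule covered_byI) (blast intro: joins_modulo_conv)

section \<open>Connected peaks\<close>

definition peaks_connected :: "'c rules \<Rightarrow> 'c rules \<Rightarrow> 'c rules \<Rightarrow> bool" where
  "peaks_connected R\<^sub>1 R\<^sub>2 E \<longleftrightarrow>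
     (\<forall>M a b. rstep C R\<^sub>1 M a \<longrightarrow> rstep C R\<^sub>2 M b \<longrightarrow> conv E (below M) a b)"

lemma peaks_connected_mono:
  assumes "peaks_connected R\<^sub>1 R\<^sub>2 E" and "R\<^sub>1' \<subseteq> R\<^sub>1" and "R\<^sub>2' \<subseteq> R\<^sub>2" and "covered_by E E'"
  shows "peaks_connected R\<^sub>1' R\<^sub>2' E'"
  unfolding peaks_connected_def
proof (intro allI impI)
  fix M a b assume "rstep C R\<^sub>1' M a" and "rstep C R\<^sub>2' M b"
  then have "rstep C R\<^sub>1 M a" and "rstep C R\<^sub>2 M b" using rstep_mono assms(2,3) by blast+
  then have "conv E (below M) a b" using assms(1) unfolding peaks_connected_def by blast
  then show "conv E' (below M) a b" by (rule covered_byD[OF assms(4) down_closed_below])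
qed

lemma peaks_connected_Un:
  assumes "peaks_connected R\<^sub>1 R\<^sub>1 E" and "peaks_connected R\<^sub>2 R\<^sub>2 E" and "peaks_connected R\<^sub>1 R\<^sub>2 E"
  shows "peaks_connected (R\<^sub>1 \<union> R\<^sub>2) (R\<^sub>1 \<union> R\<^sub>2) E"
  using assms conv_sym unfolding peaks_connected_def rstep_Un by blast

lemma peaks_connected_single_rule: "peaks_connected {\<rho>} {\<rho>} E"
  by (auto simp: peaks_connected_def rstep_def)

lemma critical_pairs_join_imp_peaks_connected:
  assumes R: "oriented C gt R" "covered_by R E" and "R\<^sub>1 \<subseteq> R" and "R\<^sub>2 \<subseteq> R"
    and joins: "\<And>\<rho>\<^sub>1 \<rho>\<^sub>2. \<rho>\<^sub>1 \<in> R\<^sub>1 \<Longrightarrow> \<rho>\<^sub>2 \<in> R\<^sub>2 \<Longrightarrow> joins_modulo R E (critical_pair \<rho>\<^sub>1 \<rho>\<^sub>2)"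
  shows "peaks_connected R\<^sub>1 R\<^sub>2 E"
  unfolding peaks_connected_def
proof (intro allI impI)
  fix M a b assume a: "rstep C R\<^sub>1 M a" and b: "rstep C R\<^sub>2 M b"
  obtain A\<^sub>1 A\<^sub>2 X\<^sub>1 where A: "(A\<^sub>1, A\<^sub>2) \<in> R\<^sub>1" "M = A\<^sub>1 + X\<^sub>1" "a = A\<^sub>2 + X\<^sub>1"
    using a unfolding rstep_iff by blast
  obtain B\<^sub>1 B\<^sub>2 X\<^sub>2 where B: "(B\<^sub>1, B\<^sub>2) \<in> R\<^sub>2" "M = B\<^sub>1 + X\<^sub>2" "b = B\<^sub>2 + X\<^sub>2"
    using b unfolding rstep_iff by blast
  obtain s t where pair: "critical_pair (A\<^sub>1, A\<^sub>2) (B\<^sub>1, B\<^sub>2) = (s, t)" by fastforce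
  obtain X where X: "a = s + X" "b = t + X"
    using peak_is_critical_pair_instance[of A\<^sub>1 X\<^sub>1 B\<^sub>1 X\<^sub>2 A\<^sub>2 B\<^sub>2] A(2,3) B(2,3)
    unfolding pair fst_conv snd_conv by metis
  have "a \<in> below M" "b \<in> below M"
    using rstep_below[OF R(1)] a b rstep_mono assms(3,4) by blast+
  moreover have "joins_modulo R E (s, t)" using joins[OF A(1) B(1)] pair by simp
  ultimately show "conv E (below M) a b"
    unfolding X by (intro joins_modulo_conv[OF R down_closed_below])
qed

lemma confluent_imp_peaks_connected:
  assumes R: "oriented C gt R" and "confluentp (rstep C R)"
  shows "peaks_connected R R R"
  unfolding peaks_connected_def
proof (intro allI impI)
  fix M a b assume peak: "rstep C R M a" "rstep C R M b"
  then have "joins_modulo R R (a, b)"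
    unfolding joins_modulo_def
    using confluentpD[OF assms(2) r_into_rtranclp r_into_rtranclp] by blast
  moreover have "a \<in> below M" "b \<in> below M" using rstep_below[OF R] peak by blast+
  ultimately show "conv R (below M) a b"
    using joins_modulo_conv[OF R covered_by_subset[OF subset_refl] down_closed_below,
        where X = "{#}"] by simp
qed

lemma peaks_connected_imp_confluent:
  assumes R: "oriented C gt R" and "peaks_connected R R R"
  shows "confluentp (rstep C R)"
proof (rule connected_below_imp_confluentp[OF wfp_below])
  show "N \<in> below M" if "rstep C R M N" for M N using rstep_below[OF R that] .
  show "equivclp (\<lambda>u v. u \<in> below M \<and> v \<in> below M \<and> rstep C R u v) a b"
    if "rstep C R M a" "rstep C R M b" for M a b
    using assms(2) that unfolding peaks_connected_def conv_def by blast
qed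

lemma confluent_imp_canonical_for_ACCC:
  assumes R: "oriented C gt R" and confluent: "confluentp (rstep C R)"
  shows "canonical_for C gt (ACCC C R) R"
proof -
  note R_Mon = oriented_subset_Mon[OF R]
  have "(s, t) \<in> ACCC C R \<longleftrightarrow> (\<exists>u. NF C R s u \<and> NF C R t u)" if "s \<in> Mon" "t \<in> Mon" for s t
  proof
    assume "(s, t) \<in> ACCC C R"
    then have "equivclp (rstep C R) s t" by (simp add: ACCC_iff_equivclp_rstep[OF R_Mon])
    then obtain u where u: "(rstep C R)\<^sup>*\<^sup>* s u" "(rstep C R)\<^sup>*\<^sup>* t u"
      unfolding semiconfluentp_equivclp[OF confluentp_imp_semiconfluentp[OF confluent]]
        rtranclp_conversep by blast
    obtain n where "NF C R u n" using NF_exists[OF R] by blast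
    then show "\<exists>u. NF C R s u \<and> NF C R t u" using u unfolding NF_def by (meson rtranclp_trans)
  next
    assume "\<exists>u. NF C R s u \<and> NF C R t u"
    then have "equivclp (rstep C R) s t"
      unfolding NF_def by (meson rtranclp_into_equivclp equivclp_sym equivclp_trans)
    then show "(s, t) \<in> ACCC C R" using that by (simp add: ACCC_iff_equivclp_rstep[OF R_Mon])
  qed
  then show ?thesis
    unfolding canonical_for_def canonical_def using R confluent wfp_rstep[OF R] by blast
qed

section \<open>Completion\<close>

definition completion_inv :: "'c rules \<Rightarrow> 'c rules \<Rightarrow> 'c rules \<Rightarrow> bool" where
  "completion_inv E R Q \<longleftrightarrow> oriented C gt R \<and> Q \<subseteq> Mon \<times> Mon \<and>
     peaks_connected R R (R \<union> Q) \<and> ACCC C (R \<union> Q) = ACCC C E"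

lemma completion_inv_subset_Mon: "completion_inv E R Q \<Longrightarrow> R \<union> Q \<subseteq> Mon \<times> Mon"
  unfolding completion_inv_def using oriented_subset_Mon by blast

lemma completion_inv_transfer:
  assumes inv: "completion_inv E R Q" and "oriented C gt R'"
    and derived: "R' \<union> Q' \<subseteq> ACCC C (R \<union> Q)" and covered: "covered_by (R \<union> Q) (R' \<union> Q')"
    and peaks: "peaks_connected R R (R' \<union> Q') \<Longrightarrow> peaks_connected R' R' (R' \<union> Q')"
  shows "completion_inv E R' Q'"
proof -
  note old_Mon = completion_inv_subset_Mon[OF inv]
  then have new_Mon: "R' \<union> Q' \<subseteq> Mon \<times> Mon" using derived ACCC_subset_monomials by blast
  have "ACCC C (R \<union> Q) = ACCC C (R' \<union> Q')"
    using covered_by_imp_ACCC_subset[OF covered old_Mon new_Mon] ACCC_least[OF derived] by blast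
  moreover have "peaks_connected R R (R' \<union> Q')"
    using inv peaks_connected_mono[OF _ subset_refl subset_refl covered]
    unfolding completion_inv_def by blast
  ultimately show ?thesis using inv assms(2) new_Mon peaks unfolding completion_inv_def by simp
qed

lemma completion_inv_simplify:
  assumes inv: "completion_inv E R (insert (l, r) Q)"
    and rsteps: "(rstep C R)\<^sup>*\<^sup>* l u" "(rstep C R)\<^sup>*\<^sup>* r v"
  shows "completion_inv E R (insert (u, v) Q)"
proof (rule completion_inv_transfer[OF inv])
  let ?old = "R \<union> insert (l, r) Q" and ?new = "R \<union> insert (u, v) Q"
  show R: "oriented C gt R" using inv by (simp add: completion_inv_def)
  note old_derived = ACCC_superset[of ?old C]
  then have "(u, v) \<in> ACCC C ?old"
    using ACCC_rsteps[OF _ completion_inv_subset_Mon[OF inv] _ rsteps] by blast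
  then show "?new \<subseteq> ACCC C ?old" using old_derived by blast
  have "joins_modulo R ?new (l, r)" using rsteps by (auto simp: joins_modulo_def)
  then have "covered_by {(l, r)} ?new"
    by (intro joins_modulo_imp_covered_by[OF R covered_by_subset]) auto
  moreover have "covered_by (R \<union> Q) ?new" by (rule covered_by_subset) blast
  ultimately show "covered_by ?old ?new" using covered_by_Un by fastforce
qed

lemma completion_inv_delete:
  assumes inv: "completion_inv E R (insert (u, u) Q)"
  shows "completion_inv E R Q"
proof (rule completion_inv_transfer[OF inv])
  show "oriented C gt R" using inv by (simp add: completion_inv_def)
  show "R \<union> Q \<subseteq> ACCC C (R \<union> insert (u, u) Q)"
    by (rule subset_trans[OF _ ACCC_superset]) blast
  show "covered_by (R \<union> insert (u, u) Q) (R \<union> Q)"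
    by (rule covered_byI) (auto intro: conv_equation)
qed

lemma completion_inv_orient:
  assumes inv: "completion_inv E R (insert (u, v) Q)"
    and \<rho>: "\<rho> = (u, v) \<or> \<rho> = (v, u)" and new: "oriented C gt (insert \<rho> R)"
    and P: "P \<subseteq> ACCC C (insert \<rho> R)"
    and joins: "\<And>\<rho>'. \<rho>' \<in> R \<Longrightarrow> joins_modulo R P (critical_pair \<rho> \<rho>')"
  shows "completion_inv E (insert \<rho> R) (Q \<union> P)"
proof (rule completion_inv_transfer[OF inv new])
  let ?old = "R \<union> insert (u, v) Q" and ?new = "insert \<rho> R \<union> (Q \<union> P)"
  note old_derived = ACCC_superset[of ?old C]
  then have "\<rho> \<in> ACCC C ?old" using \<rho> ACCC.sym by blast
  then have new_rules_derived: "insert \<rho> R \<subseteq> ACCC C ?old" using old_derived by blast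
  have "P \<subseteq> ACCC C ?old" using P ACCC_least[OF new_rules_derived] by (rule order_trans)
  then show "?new \<subseteq> ACCC C ?old" using new_rules_derived old_derived by simp
  have "joins_modulo {} ?new (u, v)" using \<rho> by (auto simp: joins_modulo_def)
  then have "covered_by {(u, v)} ?new"
    using joins_modulo_imp_covered_by[of "{}" ?new "{(u, v)}"] covered_by_subset
    by (simp add: oriented_def)
  moreover have "covered_by (R \<union> Q) ?new" by (rule covered_by_subset) blast
  ultimately show "covered_by ?old ?new" using covered_by_Un by fastforce
  have "peaks_connected {\<rho>} R ?new"
  proof (rule critical_pairs_join_imp_peaks_connected[OF new covered_by_subset])
    fix \<rho>\<^sub>1 \<rho>\<^sub>2 assume "\<rho>\<^sub>1 \<in> {\<rho>}" and "\<rho>\<^sub>2 \<in> R"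
    then have "joins_modulo R P (critical_pair \<rho>\<^sub>1 \<rho>\<^sub>2)" using joins by simp
    then show "joins_modulo (insert \<rho> R) ?new (critical_pair \<rho>\<^sub>1 \<rho>\<^sub>2)"
      by (rule joins_modulo_mono[rotated 2]) blast+
  qed blast+
  then show "peaks_connected (insert \<rho> R) (insert \<rho> R) ?new" if "peaks_connected R R ?new"
    using peaks_connected_Un[OF peaks_connected_single_rule that] by simp
qed

text \<open>
  The steps from \<open>b\<close> to \<open>b'\<close> use rules of \<open>R\<close> that may be reduced themselves, but only at monomials
  below the instance \<open>M\<close> of \<open>a\<close>: hence the induction on \<open>M\<close>.
\<close>

lemma covered_by_reduced_rules:
  assumes R: "oriented C gt R"
    and reduced: "\<And>a b. (a, b) \<in> R \<Longrightarrow> \<exists>b'. (a, b') \<in> E \<and> (rstep C R)\<^sup>*\<^sup>* b b'"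
  shows "covered_by R E"
proof -
  have "conv E D (a + X) (b + X)"
    if "M = a + X" "(a, b) \<in> R" "down_closed D" "M \<in> D" for M D a b X
    using that
  proof (induction M arbitrary: D a b X rule: wfp_induct_rule[OF wfp_below, case_names less])
    case (less M)
    have "M \<in> Mon" and below_D: "below M \<subseteq> D" using less.prems by (auto simp: down_closed_def)
    have rhs_below: "b + X \<in> below M" using rule_below[OF R] less.prems(1,2) \<open>M \<in> Mon\<close> by blast
    obtain b' where b': "(a, b') \<in> E" "(rstep C R)\<^sup>*\<^sup>* b b'" using reduced less.prems(2) by blast
    have reduct: "b' + X \<in> below M" "conv R (below M) (b + X) (b' + X)"
      using rsteps_add_conv[OF R down_closed_below b'(2) rhs_below] by blast+
    have "conv R (below M) \<le> conv E (below M)"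
      by (rule conv_le_conv) (blast intro: less.IH down_closed_below)
    then have "conv E (below M) (b + X) (b' + X)" using reduct(2) by blast
    then have "conv E D (b + X) (b' + X)" by (rule conv_mono_domain[OF below_D less.prems(3)])
    moreover have "conv E D (a + X) (b' + X)"
      using conv_equation[OF less.prems(3) b'(1)] less.prems(1,4) reduct(1) below_D by blast
    ultimately show ?case using conv_sym conv_trans by blast
  qed
  then show ?thesis by (intro covered_byI) blast
qed

lemma oriented_reduced_rules:
  assumes R: "oriented C gt R"
    and reduct: "\<And>a b'. (a, b') \<in> R' \<Longrightarrow> \<exists>b. (a, b) \<in> R \<and> (rstep C R)\<^sup>*\<^sup>* b b'"
  shows "oriented C gt R'"
proof -
  have "b' \<in> below a" if rule: "(a, b') \<in> R'" for a b'
  proof -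
    obtain b where "(a, b) \<in> R" "(rstep C R)\<^sup>*\<^sup>* b b'" using reduct[OF rule] by blast
    then show ?thesis using R rsteps_conv[OF R down_closed_below] unfolding oriented_iff by blast
  qed
  then show ?thesis unfolding oriented_iff by blast
qed

lemma peaks_connected_reduced_rules:
  assumes R: "oriented C gt R" and peaks: "peaks_connected R R E" and covered: "covered_by R E"
    and reduct: "\<And>a b'. (a, b') \<in> R' \<Longrightarrow> \<exists>b. (a, b) \<in> R \<and> (rstep C R)\<^sup>*\<^sup>* b b'"
  shows "peaks_connected R' R' E"
  unfolding peaks_connected_def
proof (intro allI impI)
  have unreduced_step: "\<exists>z. rstep C R M z \<and> conv E (below M) z y"
    if step: "rstep C R' M y" for M y
  proof -
    obtain a b' X where M: "M \<in> Mon" "M = a + X" and y: "(a, b') \<in> R'" "y = b' + X"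
      using step unfolding rstep_iff by blast
    obtain b where b: "(a, b) \<in> R" "(rstep C R)\<^sup>*\<^sup>* b b'" using reduct[OF y(1)] by blast
    have "rstep C R M (b + X)" using rstep_rule[OF b(1)] M by blast
    moreover from this have "b + X \<in> below M" by (rule rstep_below[OF R])
    then have "conv R (below M) (b + X) y"
      using rsteps_add_conv[OF R down_closed_below b(2)] y(2) by blast
    then have "conv E (below M) (b + X) y" by (rule covered_byD[OF covered down_closed_below])
    ultimately show ?thesis by blast
  qed
  fix M x y assume "rstep C R' M x" and "rstep C R' M y"
  then obtain x\<^sub>0 y\<^sub>0 where x\<^sub>0: "rstep C R M x\<^sub>0" "conv E (below M) x\<^sub>0 x"
    and y\<^sub>0: "rstep C R M y\<^sub>0" "conv E (below M) y\<^sub>0 y" using unreduced_step by blast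
  have "conv E (below M) x x\<^sub>0" using x\<^sub>0(2) by (rule conv_sym)
  also have "conv E (below M) x\<^sub>0 y\<^sub>0"
    using peaks x\<^sub>0(1) y\<^sub>0(1) unfolding peaks_connected_def by blast
  also note y\<^sub>0(2)
  finally show "conv E (below M) x y" .
qed

lemma completion_inv_reduce:
  assumes inv: "completion_inv E R Q" and Q: "Q \<subseteq> Q'" "Q' \<subseteq> R \<union> Q"
    and kept: "\<And>a b. (a, b) \<in> R - Q' \<Longrightarrow> \<exists>b'. (a, b') \<in> R' \<and> (rstep C R)\<^sup>*\<^sup>* b b'"
    and reduct: "\<And>a b'. (a, b') \<in> R' \<Longrightarrow> \<exists>b. (a, b) \<in> R \<and> (rstep C R)\<^sup>*\<^sup>* b b'"
  shows "completion_inv E R' Q'"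
proof (rule completion_inv_transfer[OF inv])
  let ?old = "R \<union> Q" and ?new = "R' \<union> Q'"
  have R: "oriented C gt R" using inv by (simp add: completion_inv_def)
  show "oriented C gt R'" using R reduct by (rule oriented_reduced_rules)
  note old_derived = ACCC_superset[of ?old C]
  have "(a, b') \<in> ACCC C ?old" if "(a, b') \<in> R'" for a b'
    using reduct[OF that] ACCC_rsteps[OF _ completion_inv_subset_Mon[OF inv], of a _ R a b']
      old_derived by blast
  then show "?new \<subseteq> ACCC C ?old" using Q(2) old_derived by auto
  have covered_rules: "covered_by R ?new"
  proof (rule covered_by_reduced_rules[OF R])
    show "\<exists>b'. (a, b') \<in> ?new \<and> (rstep C R)\<^sup>*\<^sup>* b b'" if "(a, b) \<in> R" for a b
      using kept[of a b] that by blast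
  qed
  moreover have "covered_by Q ?new" using Q(1) by (intro covered_by_subset) blast
  ultimately show "covered_by ?old ?new" by (rule covered_by_Un)
  show "peaks_connected R' R' ?new" if "peaks_connected R R ?new"
    using R that covered_rules reduct by (rule peaks_connected_reduced_rules)
qed

section \<open>The update procedure\<close>

lemma critical_pair_NFs_in_ACCC:
  assumes new: "oriented C gt (insert \<rho> R)" and "\<rho>' \<in> R"
    and "NF C R (fst (critical_pair \<rho> \<rho>')) n\<^sub>1" and "NF C R (snd (critical_pair \<rho> \<rho>')) n\<^sub>2"
  shows "(n\<^sub>1, n\<^sub>2) \<in> ACCC C (insert \<rho> R)"
proof -
  note rules_Mon = oriented_subset_Mon[OF new]
  note derived = ACCC_superset[of "insert \<rho> R" C]
  have "critical_pair \<rho> \<rho>' \<in> ACCC C (insert \<rho> R)"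
    using critical_pair_in_ACCC[OF rules_Mon] derived assms(2) by blast
  then have "(fst (critical_pair \<rho> \<rho>'), snd (critical_pair \<rho> \<rho>')) \<in> ACCC C (insert \<rho> R)" by simp
  then show ?thesis using ACCC_rsteps[OF _ rules_Mon, of _ _ R] derived assms(3,4)
    unfolding NF_def by blast
qed

lemma completion_inv_update_orient:
  assumes inv: "completion_inv E R (insert (l, r) Q)" and u: "NF C R l u" and v: "NF C R r v"
    and \<rho>: "\<rho> = (u, v) \<or> \<rho> = (v, u)" and gt: "gt (fst \<rho>) (snd \<rho>)"
    and nfs: "\<forall>\<rho>'\<in>R. NF C R (fst (critical_pair \<rho> \<rho>')) (n\<^sub>1 \<rho>') \<and>
      NF C R (snd (critical_pair \<rho> \<rho>')) (n\<^sub>2 \<rho>')"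
    and P: "P = {(n\<^sub>1 \<rho>', n\<^sub>2 \<rho>') | \<rho>'. \<rho>' \<in> R \<and> n\<^sub>1 \<rho>' \<noteq> n\<^sub>2 \<rho>'}"
    and removed: "removed \<subseteq> R"
    and n\<^sub>3: "\<forall>\<rho>'\<in>R - removed. (rstep C (insert \<rho> R))\<^sup>*\<^sup>* (snd \<rho>') (n\<^sub>3 \<rho>')"
  shows "completion_inv E (insert \<rho> {(fst \<rho>', n\<^sub>3 \<rho>') | \<rho>'. \<rho>' \<in> R - removed})
    (Q \<union> P \<union> removed)"
proof (rule completion_inv_reduce)
  let ?R' = "insert \<rho> {(fst \<rho>', n\<^sub>3 \<rho>') | \<rho>'. \<rho>' \<in> R - removed}"
  have R: "oriented C gt R" using inv by (simp add: completion_inv_def)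
  have "l \<in> Mon" "r \<in> Mon" using completion_inv_subset_Mon[OF inv] by auto
  then have "u \<in> Mon" "v \<in> Mon" using NF_in_Mon[OF R] u v by blast+
  then have new: "oriented C gt (insert \<rho> R)" using R \<rho> gt by (auto simp: oriented_def)
  have "completion_inv E R (insert (u, v) Q)"
    using completion_inv_simplify[OF inv] u v unfolding NF_def by blast
  then show "completion_inv E (insert \<rho> R) (Q \<union> P)"
  proof (rule completion_inv_orient[OF _ \<rho> new])
    show "P \<subseteq> ACCC C (insert \<rho> R)"
      unfolding P using critical_pair_NFs_in_ACCC[OF new] nfs by blast
    show "joins_modulo R P (critical_pair \<rho> \<rho>')" if "\<rho>' \<in> R" for \<rho>'
      using nfs that unfolding joins_modulo_def case_prod_beta NF_def P by blast
  qed
  show "\<exists>b'. (a, b') \<in> ?R' \<and> (rstep C (insert \<rho> R))\<^sup>*\<^sup>* b b'"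
    if unreduced: "(a, b) \<in> insert \<rho> R - (Q \<union> P \<union> removed)" for a b
  proof (cases "(a, b) = \<rho>")
    case False
    then have "(a, b) \<in> R - removed" using unreduced by blast
    then have "(fst (a, b), n\<^sub>3 (a, b)) \<in> ?R'" "(rstep C (insert \<rho> R))\<^sup>*\<^sup>* (snd (a, b)) (n\<^sub>3 (a, b))"
      using n\<^sub>3 by blast+
    then show ?thesis by auto
  qed blast
  show "\<exists>b. (a, b) \<in> insert \<rho> R \<and> (rstep C (insert \<rho> R))\<^sup>*\<^sup>* b b'"
    if unreduced': "(a, b') \<in> ?R'" for a b'
  proof (cases "(a, b') = \<rho>")
    case False
    then obtain \<rho>' where "\<rho>' \<in> R - removed" "a = fst \<rho>'" "b' = n\<^sub>3 \<rho>'" using unreduced' by blast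
    then show ?thesis using n\<^sub>3 by (intro exI[of _ "snd \<rho>'"]) simp
  qed blast
qed (use removed in blast)+

type_synonym 'a update_state = "'a rules \<times> 'a rules \<times> 'a rules \<times> ('a \<times> 'a) set"

fun update_inv :: "'c rules \<Rightarrow> 'c update_state \<Rightarrow> bool" where
  "update_inv E (S, T, R, N) \<longleftrightarrow> completion_inv E R (S \<union> T)"

lemma update_inv_step:
  assumes "update_step C gt \<sigma> \<tau>" and "update_inv E \<sigma>"
  shows "update_inv E \<tau>"
  using assms
proof (cases rule: update_step.cases)
  case (discard l r S R u T N)
  then have "insert (l, r) ((S - {(l, r)}) \<union> T) = S \<union> T" by blast
  then have "completion_inv E R (insert (l, r) ((S - {(l, r)}) \<union> T))"
    using assms(2) discard(1) by simp
  then have "completion_inv E R (insert (u, u) ((S - {(l, r)}) \<union> T))"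
    using completion_inv_simplify discard(4,5) unfolding NF_def by blast
  then show ?thesis unfolding discard(2) by (simp add: completion_inv_delete)
next
  case (orient l r S R u v l' r' n\<^sub>1 n\<^sub>2 P removed n\<^sub>3 T N)
  have "insert (l, r) ((S - {(l, r)}) \<union> T) = S \<union> T" using orient(3) by blast
  then have "completion_inv E R (insert (l, r) ((S - {(l, r)}) \<union> T))"
    using assms(2) orient(1) by simp
  moreover have "\<forall>\<rho>\<in>R - removed. (rstep C (insert (l', r') R))\<^sup>*\<^sup>* (snd \<rho>) (n\<^sub>3 \<rho>)"
    using orient(12) by (auto simp: NF_def split: if_splits)
  moreover have "removed \<subseteq> R" using orient(11) by blast
  moreover have "gt (fst (l', r')) (snd (l', r'))" using orient(8) by simp
  ultimately show ?thesis
    unfolding orient(2) update_inv.simps Un_assoc[symmetric]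
    by (intro completion_inv_update_orient[OF _ orient(4,5,7) _ orient(9,10)])
next
  case (next_round T R N)
  then show ?thesis using assms(2) by simp
qed

lemma orient_step_exists:
  assumes R: "oriented C gt R" and equation: "(l, r) \<in> S" "l \<in> Mon" "r \<in> Mon"
    and u: "NF C R l u" and v: "NF C R r v" and "u \<noteq> v"
  shows "\<exists>\<tau>. update_step C gt (S, T, R, N) \<tau>"
proof -
  have "u \<in> Mon" "v \<in> Mon" using NF_in_Mon[OF R] u v equation by blast+
  then obtain l' r' where new_rule: "(l', r') = (u, v) \<or> (l', r') = (v, u)" "r' \<in> below l'"
    using below_total[OF \<open>u \<noteq> v\<close>] by blast
  then have new_oriented: "oriented C gt (insert (l', r') R)" using R by (simp add: oriented_iff)
  obtain nf where nf: "\<And>M. NF C R M (nf M)" using NF_exists[OF R] by metis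
  obtain nf' where nf': "\<And>M. NF C (insert (l', r') R) M (nf' M)"
    using NF_exists[OF new_oriented] by metis
  define n\<^sub>1 n\<^sub>2 n\<^sub>3 where "n\<^sub>1 \<rho> = nf (fst (critical_pair (l', r') \<rho>))"
    and "n\<^sub>2 \<rho> = nf (snd (critical_pair (l', r') \<rho>))"
    and "n\<^sub>3 \<rho> = (if reducible C {(l', r')} (snd \<rho>) then nf' (snd \<rho>) else snd \<rho>)"
    for \<rho>
  have "\<forall>\<rho>\<in>R. NF C R (fst (critical_pair (l', r') \<rho>)) (n\<^sub>1 \<rho>) \<and>
      NF C R (snd (critical_pair (l', r') \<rho>)) (n\<^sub>2 \<rho>)"
    by (simp add: n\<^sub>1_def n\<^sub>2_def nf)
  moreover have "\<forall>\<rho>\<in>R - removed. if reducible C {(l', r')} (snd \<rho>)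
      then NF C (insert (l', r') R) (snd \<rho>) (n\<^sub>3 \<rho>) else n\<^sub>3 \<rho> = snd \<rho>" for removed
    by (simp add: n\<^sub>3_def nf')
  moreover have "gt l' r'" using new_rule(2) by (simp add: below_def)
  ultimately show ?thesis
    using update_step.orient[OF equation(1) u v \<open>u \<noteq> v\<close> new_rule(1) _ _ HOL.refl HOL.refl] by blast
qed

lemma update_step_exists:
  assumes "update_inv E (S, T, R, N)" and "\<not> (S = {} \<and> T = {})"
  shows "\<exists>\<tau>. update_step C gt (S, T, R, N) \<tau>"
proof (cases "S = {}")
  case True
  then show ?thesis using assms(2) update_step.next_round by blast
next
  case False
  then obtain l r where equation: "(l, r) \<in> S" by auto
  have R: "oriented C gt R" using assms(1) by (simp add: completion_inv_def)
  have sides_Mon: "l \<in> Mon" "r \<in> Mon"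
    using completion_inv_subset_Mon equation assms(1) by fastforce+
  obtain u v where NFs: "NF C R l u" "NF C R r v" using NF_exists[OF R] by blast
  show ?thesis
  proof (cases "u = v")
    case True
    then show ?thesis using update_step.discard[OF equation] NFs by blast
  next
    case False
    then show ?thesis using orient_step_exists[OF R equation sides_Mon NFs] by blast
  qed
qed

lemma update_inv_final:
  assumes "update_inv E ({}, {}, R, N)"
  shows "canonical_for C gt (ACCC C E) R"
proof -
  have R: "oriented C gt R" and "peaks_connected R R R" and "ACCC C R = ACCC C E"
    using assms by (simp_all add: completion_inv_def)
  then show ?thesis
    using confluent_imp_canonical_for_ACCC[OF R peaks_connected_imp_confluent] by simp
qed

lemma disjoint_lhs_joins_modulo:
  assumes "l\<^sub>1 \<inter># l\<^sub>2 = {#}" and "(l\<^sub>1, r\<^sub>1) \<in> R" and "(l\<^sub>2, r\<^sub>2) \<in> R" and "R \<subseteq> Mon \<times> Mon"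
  shows "joins_modulo R E (critical_pair (l\<^sub>1, r\<^sub>1) (l\<^sub>2, r\<^sub>2))"
proof -
  have "count l\<^sub>1 x = 0 \<or> count l\<^sub>2 x = 0" for x
    using assms(1) by (metis disjunct_not_in not_in_iff)
  then have "l\<^sub>1 - l\<^sub>2 = l\<^sub>1" "l\<^sub>2 - l\<^sub>1 = l\<^sub>2"
    by (metis multiset_eqI count_diff diff_zero diff_0_eq_0)+
  then have "critical_pair (l\<^sub>1, r\<^sub>1) (l\<^sub>2, r\<^sub>2) = (l\<^sub>2 + r\<^sub>1, l\<^sub>1 + r\<^sub>2)"
    unfolding critical_pair_eq by simp
  moreover have "l\<^sub>2 + r\<^sub>1 \<in> Mon" "l\<^sub>1 + r\<^sub>2 \<in> Mon" using assms(2-4) by (auto simp: monomials_def)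
  then have "rstep C R (l\<^sub>2 + r\<^sub>1) (r\<^sub>2 + r\<^sub>1)" "rstep C R (l\<^sub>1 + r\<^sub>2) (r\<^sub>1 + r\<^sub>2)"
    using rstep_rule[OF assms(3)] rstep_rule[OF assms(2)] by blast+
  ultimately show ?thesis unfolding joins_modulo_def by (auto simp: add.commute)
qed

lemma rsteps_const_rules:
  assumes "oriented C gt (const_rules R\<^sub>C)" and "(\<lambda>c d. (c, d) \<in> R\<^sub>C)\<^sup>*\<^sup>* c d"
  shows "(rstep C (const_rules R\<^sub>C))\<^sup>*\<^sup>* {#c#} {#d#}"
  using assms(2)
proof (induction rule: rtranclp_induct)
  case (step y z)
  then have "({#y#}, {#z#}) \<in> const_rules R\<^sub>C" by (auto simp: const_rules_def)
  moreover from this have "{#y#} \<in> Mon" using oriented_subset_Mon[OF assms(1)] by blast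
  ultimately have "rstep C (const_rules R\<^sub>C) {#y#} {#z#}"
    using rstep_rule[of "{#y#}" "{#z#}" _ "{#}"] by simp
  then show ?case using step.IH by simp
qed simp

lemma peaks_connected_const_rules:
  assumes R\<^sub>C: "oriented C gt (const_rules R\<^sub>C)" and confluent: "confluentp (\<lambda>c d. (c, d) \<in> R\<^sub>C)"
  shows "peaks_connected (const_rules R\<^sub>C) (const_rules R\<^sub>C) (const_rules R\<^sub>C)"
proof (rule critical_pairs_join_imp_peaks_connected[OF R\<^sub>C covered_by_subset])
  fix \<rho>\<^sub>1 \<rho>\<^sub>2 assume rules: "\<rho>\<^sub>1 \<in> const_rules R\<^sub>C" "\<rho>\<^sub>2 \<in> const_rules R\<^sub>C"
  then obtain c d c' d' where \<rho>: "\<rho>\<^sub>1 = ({#c#}, {#d#})" "(c, d) \<in> R\<^sub>C"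
    "\<rho>\<^sub>2 = ({#c'#}, {#d'#})" "(c', d') \<in> R\<^sub>C"
    by (auto simp: const_rules_def)
  show "joins_modulo (const_rules R\<^sub>C) (const_rules R\<^sub>C) (critical_pair \<rho>\<^sub>1 \<rho>\<^sub>2)"
  proof (cases "c = c'")
    case True
    obtain e where "(\<lambda>c d. (c, d) \<in> R\<^sub>C)\<^sup>*\<^sup>* d e" "(\<lambda>c d. (c, d) \<in> R\<^sub>C)\<^sup>*\<^sup>* d' e"
      using confluentpD[OF confluent r_into_rtranclp r_into_rtranclp] \<rho>(2,4) True by blast
    then have "(rstep C (const_rules R\<^sub>C))\<^sup>*\<^sup>* {#d#} {#e#}"
      and "(rstep C (const_rules R\<^sub>C))\<^sup>*\<^sup>* {#d'#} {#e#}"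
      using rsteps_const_rules[OF R\<^sub>C] by blast+
    then show ?thesis using True by (auto simp: \<rho>(1,3) joins_modulo_def)
  next
    case False
    then have "{#c#} \<inter># {#c'#} = {#}" by simp
    then show ?thesis
      using disjoint_lhs_joins_modulo[OF _ _ _ oriented_subset_Mon[OF R\<^sub>C]] rules unfolding \<rho>(1,3)
      by blast
  qed
qed blast+

lemma irreducible_imp_disjoint_const_rules:
  assumes "l \<in> Mon" and "\<not> reducible C (const_rules R\<^sub>C) l" and "(k, d) \<in> const_rules R\<^sub>C"
  shows "k \<inter># l = {#}"
proof -
  obtain c where "k = {#c#}" using assms(3) by (auto simp: const_rules_def)
  moreover have "\<not> k \<subseteq># l" using assms unfolding reducible_iff by blast
  ultimately show ?thesis by (auto simp: disjunct_not_in)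
qed

lemma peaks_connected_const_rules_irreducible:
  assumes R: "oriented C gt (const_rules R\<^sub>C \<union> R)" and "const_rules R\<^sub>C \<union> R \<subseteq> E"
    and irreducible: "\<And>l r. (l, r) \<in> R \<Longrightarrow> \<not> reducible C (const_rules R\<^sub>C) l"
  shows "peaks_connected (const_rules R\<^sub>C) R E"
proof (rule critical_pairs_join_imp_peaks_connected[OF R covered_by_subset])
  note rules_Mon = oriented_subset_Mon[OF R]
  fix \<rho>\<^sub>1 \<rho>\<^sub>2 assume rules: "\<rho>\<^sub>1 \<in> const_rules R\<^sub>C" "\<rho>\<^sub>2 \<in> R"
  obtain k d l r where \<rho>: "\<rho>\<^sub>1 = (k, d)" "\<rho>\<^sub>2 = (l, r)" by fastforce
  have "k \<inter># l = {#}"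
    using irreducible_imp_disjoint_const_rules irreducible rules_Mon rules unfolding \<rho> by blast
  then show "joins_modulo (const_rules R\<^sub>C \<union> R) E (critical_pair \<rho>\<^sub>1 \<rho>\<^sub>2)"
    using disjoint_lhs_joins_modulo[OF _ _ _ rules_Mon] rules unfolding \<rho> by blast
qed (use assms(2) in blast)+

lemma update_inv_init:
  assumes R\<^sub>f: "oriented C gt R\<^sub>f" "confluentp (rstep C R\<^sub>f)"
    and R\<^sub>C: "oriented C gt (const_rules R\<^sub>C)" and "confluentp (\<lambda>c d. (c, d) \<in> R\<^sub>C)"
  shows "update_inv (R\<^sub>f \<union> const_rules R\<^sub>C) (update_init C R\<^sub>f R\<^sub>C)"
proof -
  let ?K = "const_rules R\<^sub>C"
  define S where "S = {(l, r) \<in> R\<^sub>f. \<exists>l'. NF C ?K l l' \<and> l' \<noteq> l}"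
  have init: "update_init C R\<^sub>f R\<^sub>C = (S, {}, ?K \<union> (R\<^sub>f - S), {})"
    unfolding update_init_def S_def Let_def ..
  have equations: "(?K \<union> (R\<^sub>f - S)) \<union> S = R\<^sub>f \<union> ?K" by (auto simp: S_def)
  have R: "oriented C gt (?K \<union> (R\<^sub>f - S))" using R\<^sub>C R\<^sub>f(1) by (auto simp: oriented_def)
  have "\<not> reducible C ?K l" if "(l, r) \<in> R\<^sub>f - S" for l r
  proof -
    obtain n where "NF C ?K l n" using NF_exists[OF R\<^sub>C] by blast
    moreover from this have "n = l" using that unfolding S_def by blast
    ultimately show ?thesis by (simp add: NF_def)
  qed
  then have "peaks_connected ?K (R\<^sub>f - S) (R\<^sub>f \<union> ?K)"
    by (intro peaks_connected_const_rules_irreducible[OF R]) blast+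
  moreover have "peaks_connected ?K ?K (R\<^sub>f \<union> ?K)"
    by (rule peaks_connected_mono[OF peaks_connected_const_rules[OF R\<^sub>C assms(4)] _ _
          covered_by_subset]) blast+
  moreover have "peaks_connected (R\<^sub>f - S) (R\<^sub>f - S) (R\<^sub>f \<union> ?K)"
    by (rule peaks_connected_mono[OF confluent_imp_peaks_connected[OF R\<^sub>f] _ _
          covered_by_subset]) blast+
  ultimately have "peaks_connected (?K \<union> (R\<^sub>f - S)) (?K \<union> (R\<^sub>f - S)) (R\<^sub>f \<union> ?K)"
    by (intro peaks_connected_Un)
  moreover have "S \<subseteq> Mon \<times> Mon" using oriented_subset_Mon[OF R\<^sub>f(1)] by (auto simp: S_def)
  ultimately show ?thesis using R by (simp add: init completion_inv_def equations)
qed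

section \<open>Termination\<close>

fun finite_state :: "'c update_state \<Rightarrow> bool" where
  "finite_state (S, T, R, N) \<longleftrightarrow> finite S \<and> finite T \<and> finite R"

text \<open>The factor 2 makes the assignments \<open>S := T\<close>, \<open>T := \<emptyset>\<close> decreasing.\<close>

fun pending :: "'c update_state \<Rightarrow> nat" where
  "pending (S, T, R, N) = card S + 2 * card T"

fun reducibles :: "'c update_state \<Rightarrow> 'c multiset set" where
  "reducibles (S, T, R, N) = {M. reducible C R M}"

lemma finite_state_step:
  assumes "update_step C gt \<sigma> \<tau>" and "finite_state \<sigma>"
  shows "finite_state \<tau>"
  using assms
proof (cases rule: update_step.cases)
  case (orient l r S R u v l' r' n\<^sub>1 n\<^sub>2 P removed n\<^sub>3 T N)
  have "P \<subseteq> (\<lambda>\<rho>. (n\<^sub>1 \<rho>, n\<^sub>2 \<rho>)) ` R" unfolding orient(10) by blast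
  moreover have "{(fst \<rho>, n\<^sub>3 \<rho>) | \<rho>. \<rho> \<in> R - removed} \<subseteq> (\<lambda>\<rho>. (fst \<rho>, n\<^sub>3 \<rho>)) ` R" by blast
  moreover have "removed \<subseteq> R" unfolding orient(11) by blast
  moreover have "finite R" "finite S" "finite T" using assms(2) orient(1) by simp_all
  ultimately show ?thesis
    unfolding orient(2) finite_state.simps
    by (meson finite_Un finite_Diff finite.insertI finite_surj finite_subset)
qed auto

lemma update_step_progress:
  assumes "update_step C gt \<sigma> \<tau>" and "update_inv E \<sigma>" and "finite_state \<sigma>"
  shows "reducibles \<sigma> \<subset> reducibles \<tau> \<or> reducibles \<sigma> = reducibles \<tau> \<and> pending \<tau> < pending \<sigma>"
  using assms(1)
proof (cases rule: update_step.cases)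
  case (discard l r S R u T N)
  then have "card (S - {(l, r)}) < card S" using assms(3) by (intro card_Diff1_less) simp_all
  then show ?thesis using discard(1,2) by simp
next
  case (orient l r S R u v l' r' n\<^sub>1 n\<^sub>2 P removed n\<^sub>3 T N)
  have inv: "completion_inv E R (S \<union> T)" using assms(2) orient(1) by simp
  then have R: "oriented C gt R" by (simp add: completion_inv_def)
  have "l \<in> Mon" "r \<in> Mon" using completion_inv_subset_Mon[OF inv] orient(3) by auto
  then have "u \<in> Mon" "v \<in> Mon" using NF_in_Mon[OF R] orient(4,5) by blast+
  then have "l' \<in> Mon" "\<not> reducible C R l'" using orient(4,5,7) by (auto simp: NF_def)
  then show ?thesis
    using reducible_insert_psubset[of "(l', r')" C R _ n\<^sub>3] unfolding orient(1,2,11) by simp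
next
  case (next_round T R N)
  then show ?thesis using assms(3) by (simp add: card_gt_0_iff)
qed

definition invariant_step ::
  "'c rules \<Rightarrow> 'c update_state \<Rightarrow> 'c update_state \<Rightarrow> bool" where
  "invariant_step E \<sigma> \<tau> \<longleftrightarrow> update_inv E \<sigma> \<and> finite_state \<sigma> \<and> update_step C gt \<sigma> \<tau>"

lemma wfp_invariant_step:
  assumes "finite C"
  shows "wfp (invariant_step E)\<inverse>\<inverse>"
proof (rule wfp_if_convertible_to_wfp)
  let ?less = "{(V, U). upward_closed C U \<and> upward_closed C V \<and> U \<subset> V} <*lex*> less_than"
  show "wfp (\<lambda>x y. (x, y) \<in> ?less)"
    unfolding wfp_wf_eq by (intro wf_lex_prod wf_upward_closed_superset[OF assms] wf_less_than)
  have upward_closed: "upward_closed C (reducibles \<sigma>)" for \<sigma>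
    by (cases \<sigma>) (simp add: upward_closed_reducible)
  show "((reducibles \<tau>, pending \<tau>), (reducibles \<sigma>, pending \<sigma>)) \<in> ?less"
    if "(invariant_step E)\<inverse>\<inverse> \<tau> \<sigma>" for \<sigma> \<tau>
    using that update_step_progress[of \<sigma> \<tau> E] upward_closed by (auto simp: invariant_step_def)
qed

lemma update_steps_terminate:
  assumes "finite C" and "update_inv E (\<sigma> 0)" and "finite_state (\<sigma> 0)"
  shows "\<not> (\<forall>i::nat. update_step C gt (\<sigma> i) (\<sigma> (Suc i)))"
proof
  assume steps: "\<forall>i. update_step C gt (\<sigma> i) (\<sigma> (Suc i))"
  have "update_inv E (\<sigma> i) \<and> finite_state (\<sigma> i)" for i
    by (induction i) (use assms(2,3) steps update_inv_step finite_state_step in blast)+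
  then have "\<forall>i. (\<sigma> (Suc i), \<sigma> i) \<in> {(\<tau>, \<sigma>). (invariant_step E)\<inverse>\<inverse> \<tau> \<sigma>}"
    using steps by (simp add: invariant_step_def)
  then show False
    using wfp_invariant_step[OF assms(1)] unfolding wfp_def wf_iff_no_infinite_down_chain by blast
qed

lemma update_steps_reach_final:
  assumes "finite C" and "update_inv E \<sigma>" and "finite_state \<sigma>"
  shows "\<exists>R N. (update_step C gt)\<^sup>*\<^sup>* \<sigma> ({}, {}, R, N)"
proof -
  obtain \<tau> where steps: "(invariant_step E)\<^sup>*\<^sup>* \<sigma> \<tau>" and final: "\<nexists>\<upsilon>. invariant_step E \<tau> \<upsilon>"
    using wfp_imp_ex_normal_form[OF wfp_invariant_step[OF assms(1)]] by blast
  have "(update_step C gt)\<^sup>*\<^sup>* \<sigma> \<tau> \<and> update_inv E \<tau> \<and> finite_state \<tau>"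
    using steps
  proof (induction rule: rtranclp_induct)
    case (step \<tau> \<upsilon>)
    then show ?case
      unfolding invariant_step_def
      by (meson rtranclp.rtrancl_into_rtrancl update_inv_step finite_state_step)
  qed (use assms(2,3) in blast)
  moreover obtain S T R N where "\<tau> = (S, T, R, N)" by (cases \<tau>)
  ultimately show ?thesis
    using final update_step_exists unfolding invariant_step_def by blast
qed

lemma finite_update_init:
  assumes "finite R\<^sub>f" and "finite R\<^sub>C"
  shows "finite_state (update_init C R\<^sub>f R\<^sub>C)"
proof -
  have "const_rules R\<^sub>C = (\<lambda>(c, d). ({#c#}, {#d#})) ` R\<^sub>C" by (auto simp: const_rules_def)
  then have "finite (const_rules R\<^sub>C)" using assms(2) by simp
  moreover have "finite {(l, r) \<in> R\<^sub>f. \<exists>l'. NF C (const_rules R\<^sub>C) l l' \<and> l' \<noteq> l}"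
    using assms(1) by (rule rev_finite_subset) blast
  ultimately show ?thesis using assms(1) by (simp add: update_init_def Let_def)
qed

lemma update_AC_canonical:
  assumes "oriented C gt R\<^sub>f" and "confluentp (rstep C R\<^sub>f)"
    and "oriented C gt (const_rules R\<^sub>C)" and "confluentp (\<lambda>c d. (c, d) \<in> R\<^sub>C)"
    and run: "update_AC C gt R\<^sub>f R\<^sub>C R' N"
  shows "canonical_for C gt (ACCC C (R\<^sub>f \<union> const_rules R\<^sub>C)) R'"
proof (rule update_inv_final)
  show "update_inv (R\<^sub>f \<union> const_rules R\<^sub>C) ({}, {}, R', N)"
    using run unfolding update_AC_def
    by (induction rule: rtranclp_induct)
      (use update_inv_init[OF assms(1-4)] update_inv_step in blast)+
qed

end

theorem theorem6p2:
  fixes C :: "'c set"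
    and gt\<^sub>C :: "'c \<Rightarrow> 'c \<Rightarrow> bool"
    and gt\<^sub>f :: "'c multiset \<Rightarrow> 'c multiset \<Rightarrow> bool"
    and R\<^sub>f :: "('c multiset \<times> 'c multiset) set"
    and R\<^sub>C :: "('c \<times> 'c) set"
  assumes "finite C"
    and "strict_total_order_on C gt\<^sub>C"
    and "admissible C gt\<^sub>f"
    and "\<forall>c\<in>C. \<forall>d\<in>C. gt\<^sub>C c d \<longrightarrow> gt\<^sub>f {#c#} {#d#}"
    and "\<forall>M\<in>monomials C. (\<nexists>c. M = {#c#}) \<longrightarrow> (\<forall>d\<in>C. gt\<^sub>f M {#d#})"
    and "oriented C gt\<^sub>f R\<^sub>f"
    and "canonical (rstep C R\<^sub>f)"
    and "\<forall>(c, d)\<in>R\<^sub>C. c \<in> C \<and> d \<in> C \<and> gt\<^sub>C c d"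
    and "canonical (\<lambda>c d. (c, d) \<in> R\<^sub>C)"
  shows "(finite R\<^sub>f \<longrightarrow>
            update_AC_terminates C gt\<^sub>f R\<^sub>f R\<^sub>C \<and> (\<exists>R' N. update_AC C gt\<^sub>f R\<^sub>f R\<^sub>C R' N)) \<and>
         (\<forall>R' N. update_AC C gt\<^sub>f R\<^sub>f R\<^sub>C R' N \<longrightarrow>
            canonical_for C gt\<^sub>f
              (ACCC C ({(l, r) | l r. (l, r) \<in> R\<^sub>f} \<union> {({#c#}, {#d#}) | c d. (c, d) \<in> R\<^sub>C})) R')"
proof -
  interpret admissible_order C gt\<^sub>f using assms(3) by unfold_locales
  have equations: "{(l, r) | l r. (l, r) \<in> R\<^sub>f} \<union> {({#c#}, {#d#}) | c d. (c, d) \<in> R\<^sub>C} =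
      R\<^sub>f \<union> const_rules R\<^sub>C"
    by (simp add: const_rules_def)
  have R\<^sub>C: "oriented C gt\<^sub>f (const_rules R\<^sub>C)"
    using assms(4,8) by (auto simp: oriented_def const_rules_def monomials_def)
  have confluent: "confluentp (rstep C R\<^sub>f)" "confluentp (\<lambda>c d. (c, d) \<in> R\<^sub>C)"
    using assms(7,9) by (simp_all add: canonical_def)
  have inv: "update_inv (R\<^sub>f \<union> const_rules R\<^sub>C) (update_init C R\<^sub>f R\<^sub>C)"
    using assms(6) confluent(1) R\<^sub>C confluent(2) by (rule update_inv_init)
  have "finite R\<^sub>C" using assms(1,8) by (intro finite_subset[of R\<^sub>C "C \<times> C"]) auto
  then have finite: "finite_state (update_init C R\<^sub>f R\<^sub>C)" if "finite R\<^sub>f"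
    using that by (intro finite_update_init)
  have "update_AC_terminates C gt\<^sub>f R\<^sub>f R\<^sub>C" if "finite R\<^sub>f"
    using update_steps_terminate[OF assms(1)] inv finite[OF that]
    unfolding update_AC_terminates_def by metis
  moreover have "\<exists>R' N. update_AC C gt\<^sub>f R\<^sub>f R\<^sub>C R' N" if "finite R\<^sub>f"
    using update_steps_reach_final[OF assms(1) inv finite[OF that]] by (simp add: update_AC_def)
  ultimately show ?thesis
    unfolding equations
    using update_AC_canonical[OF assms(6) confluent(1) R\<^sub>C confluent(2)] by blast
qed

end
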